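(* For each $n\in\{1,2,3\}$ there exists a three-qubit state $\varrho_{ABC}$ (a density operator on $\mathbb{C}^2\otimes\mathbb{C}^2\otimes\mathbb{C}^2$) such that: (i) $\varrho_{ABC}$ violates the Bell inequality $F_n\ge 0$, i.e. there are dichotomic qubit observables $A_1,A_2,A_3$ for party $A$, $B_1,B_2,B_3$ for party $B$ and $C_1,C_2,C_3$ for party $C$ for which the quantum value of $F_n$ in the state $\varrho_{ABC}$ is strictly negative; (ii) all three two-party reduced states $\varrho_{AB}$, $\varrho_{AC}$, $\varrho_{BC}$ of $\varrho_{ABC}$ are separable; (iii) $\varrho_{ABC}$ has a symmetric extension $H_{ABB'CC'}$; in particular, $\varrho_{ABC}$ violates no Bell inequality with an arbitrary number of measurement settings for party $A$ and two measurement settings for each of the parties $B$ and $C$, with an arbitrary number of outcomes per setting.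
   Context: Three parties $A,B,C$ each have three dichotomic measurements with outcomes $\pm1$, described by observables $A_i,B_j,C_k$ ($i,j,k\in\{1,2,3\}$); a dichotomic observable on a qubit is a Hermitian $2\times 2$ matrix with eigenvalues in $\{-1,+1\}$ (trivial observables $\pm\mathbb{1}$ allowed). Index $0$ denotes the trivial measurement always yielding $+1$: $A_0=B_0=C_0=\mathbb{1}$. For indices $i,j,k\in\{0,1,2,3\}$ the symbol $(ijk)$ denotes the sum of $\langle A_{i'}B_{j'}C_{k'}\rangle$ over all distinct triples $(i',j',k')$ that are permutations of $(i,j,k)$, each distinct triple counted once; for example $(112)=\langle A_1B_1C_2\rangle+\langle A_1B_2C_1\rangle+\langle A_2B_1C_1\rangle$. In a quantum state $\varrho_{ABC}$, $\langle A_iB_jC_k\rangle=\mathrm{Tr}[\varrho_{ABC}\,(A_i\otimes B_j\otimes C_k)]$. The expressions $F_n$ are $F_1=8+(110)-(210)+(211)+(220)+(222)-2(331)-2(332)$, $F_2=9+(110)+2(220)-2(221)-(300)-(310)+(311)-2(322)$, $F_3=9-(210)+(211)+(220)+3(222)-(300)-(310)+(311)-2(322)$. The inequalities $F_n\ge 0$ are Bell inequalities, i.e. they hold for all local hidden variable (LHV) models. A symmetric extension of $\varrho_{ABC}$ is a five-qubit state (positive semidefinite operator) $H_{ABB'CC'}$ that is invariant under exchange of the qubits $B$ and $B'$, and invariant under exchange of the qubits $C$ and $C'$, and satisfies $\mathrm{Tr}_{B'C'}(H_{ABB'CC'})=\varrho_{ABC}$. That a state violates no Bell inequality for a given number of settings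 and outcomes means: for every choice of that many measurements (POVMs) with that many outcomes for each party, the resulting collection of outcome probabilities $p(a,b,c|x,y,z)$ admits an LHV model, i.e. is a convex combination of local deterministic assignments. *)

theory Defs
  imports "HOL-Analysis.Analysis"
begin

text \<open>
  The Hilbert space with orthonormal basis indexed by \<open>'n\<close> is \<open>complex ^ 'n\<close>; a tensor product
  of spaces is indexed by the product of the index types, and a qubit by the two-element
  type \<open>2\<close>.
\<close>

type_synonym 'n operator = "((complex, 'n) vec, 'n) vec"

type_synonym qubit = 2

definition hermitian :: "'n::finite operator \<Rightarrow> bool" where
  "hermitian M \<longleftrightarrow> (\<forall>i j. M $ i $ j = cnj (M $ j $ i))"

definition positive_semidefinite :: "'n::finite operator \<Rightarrow> bool" where
  "positive_semidefinite M \<longleftrightarrow>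
     hermitian M \<and> (\<forall>v :: complex ^ 'n. 0 \<le> Re (\<Sum>i\<in>UNIV. cnj (v $ i) * (M *v v) $ i))"

definition density_operator :: "'n::finite operator \<Rightarrow> bool" where
  "density_operator \<rho> \<longleftrightarrow> positive_semidefinite \<rho> \<and> trace \<rho> = 1"

definition tensor :: "'a::finite operator \<Rightarrow> 'b::finite operator \<Rightarrow> ('a \<times> 'b) operator" where
  "tensor M N = (\<chi> i j. M $ fst i $ fst j * N $ snd i $ snd j)"

definition tensor3 ::
  "'a::finite operator \<Rightarrow> 'b::finite operator \<Rightarrow> 'c::finite operator \<Rightarrow> ('a \<times> 'b \<times> 'c) operator"
  where "tensor3 M N P = tensor M (tensor N P)"

definition reduced_AB ::
  "('a::finite \<times> 'b::finite \<times> 'c::finite) operator \<Rightarrow> ('a \<times> 'b) operator" where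
  "reduced_AB \<rho> = (\<chi> i j. \<Sum>c\<in>UNIV. \<rho> $ (fst i, snd i, c) $ (fst j, snd j, c))"

definition reduced_AC ::
  "('a::finite \<times> 'b::finite \<times> 'c::finite) operator \<Rightarrow> ('a \<times> 'c) operator" where
  "reduced_AC \<rho> = (\<chi> i j. \<Sum>b\<in>UNIV. \<rho> $ (fst i, b, snd i) $ (fst j, b, snd j))"

definition reduced_BC ::
  "('a::finite \<times> 'b::finite \<times> 'c::finite) operator \<Rightarrow> ('b \<times> 'c) operator" where
  "reduced_BC \<rho> = (\<chi> i j. \<Sum>a\<in>UNIV. \<rho> $ (a, fst i, snd i) $ (a, fst j, snd j))"

definition separable :: "('a::finite \<times> 'b::finite) operator \<Rightarrow> bool" where
  "separable \<sigma> \<longleftrightarrow>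
     (\<exists>(N::nat) (p :: nat \<Rightarrow> real) (\<alpha> :: nat \<Rightarrow> 'a operator) (\<beta> :: nat \<Rightarrow> 'b operator).
        (\<forall>k<N. 0 \<le> p k \<and> density_operator (\<alpha> k) \<and> density_operator (\<beta> k)) \<and>
        (\<Sum>k<N. p k) = 1 \<and>
        \<sigma> = (\<Sum>k<N. p k *\<^sub>R tensor (\<alpha> k) (\<beta> k)))"

text \<open>
  The tensor factors of \<open>H\<close> are ordered as \<open>A, B, B', C, C'\<close>.  Invariance under an exchange of
  two factors means invariance under conjugation with the corresponding swap operator, that is,
  exchanging the two indices simultaneously in rows and columns leaves \<open>H\<close> unchanged.
\<close>

definition swap_BB' ::
  "('a::finite \<times> 'b::finite \<times> 'b \<times> 'c::finite \<times> 'c) operator \<Rightarrow> ('a \<times> 'b \<times> 'b \<times> 'c \<times> 'c) operator"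
  where "swap_BB' H =
    (\<chi> i j. case (i, j) of ((a, b, b', c, c'), (d, e, e', f, f')) \<Rightarrow>
       H $ (a, b', b, c, c') $ (d, e', e, f, f'))"

definition swap_CC' ::
  "('a::finite \<times> 'b::finite \<times> 'b \<times> 'c::finite \<times> 'c) operator \<Rightarrow> ('a \<times> 'b \<times> 'b \<times> 'c \<times> 'c) operator"
  where "swap_CC' H =
    (\<chi> i j. case (i, j) of ((a, b, b', c, c'), (d, e, e', f, f')) \<Rightarrow>
       H $ (a, b, b', c', c) $ (d, e, e', f', f))"

definition trace_B'C' ::
  "('a::finite \<times> 'b::finite \<times> 'b \<times> 'c::finite \<times> 'c) operator \<Rightarrow> ('a \<times> 'b \<times> 'c) operator" where
  "trace_B'C' H =
    (\<chi> i j. case (i, j) of ((a, b, c), (d, e, f)) \<Rightarrow>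
       \<Sum>b'\<in>UNIV. \<Sum>c'\<in>UNIV. H $ (a, b, b', c, c') $ (d, e, b', f, c'))"

definition symmetric_extension ::
  "('a::finite \<times> 'b::finite \<times> 'b \<times> 'c::finite \<times> 'c) operator \<Rightarrow> ('a \<times> 'b \<times> 'c) operator \<Rightarrow> bool"
  where "symmetric_extension H \<rho> \<longleftrightarrow>
    density_operator H \<and> swap_BB' H = H \<and> swap_CC' H = H \<and> trace_B'C' H = \<rho>"

definition dichotomic_observable :: "qubit operator \<Rightarrow> bool" where
  "dichotomic_observable M \<longleftrightarrow>
     hermitian M \<and> (\<forall>(\<mu>::complex) v. v \<noteq> 0 \<and> M *v v = \<mu> *s v \<longrightarrow> \<mu> \<in> {-1, 1})"

text \<open>
  The traces below are real whenever \<open>\<rho>\<close> and the local operators are Hermitian, so taking the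
  real part loses nothing.
\<close>

definition expectation ::
  "('a::finite \<times> 'b::finite \<times> 'c::finite) operator \<Rightarrow>
     'a operator \<Rightarrow> 'b operator \<Rightarrow> 'c operator \<Rightarrow> real" where
  "expectation \<rho> M N P = Re (trace (\<rho> ** tensor3 M N P))"

text \<open>
  For a table \<open>E i j k\<close> of correlations, \<open>sym_corr E i j k\<close> is the symbol \<open>(ijk)\<close>.  It is a sum
  over a set of triples: permutations that coincide are counted once.
\<close>

definition sym_corr :: "(nat \<Rightarrow> nat \<Rightarrow> nat \<Rightarrow> real) \<Rightarrow> nat \<Rightarrow> nat \<Rightarrow> nat \<Rightarrow> real" where
  "sym_corr E i j k =
     (\<Sum>(i', j', k') \<in> {(i,j,k), (i,k,j), (j,i,k), (j,k,i), (k,i,j), (k,j,i)}. E i' j' k')"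

definition bell_F1 :: "(nat \<Rightarrow> nat \<Rightarrow> nat \<Rightarrow> real) \<Rightarrow> real" where
  "bell_F1 E = 8 + sym_corr E 1 1 0 - sym_corr E 2 1 0 + sym_corr E 2 1 1 + sym_corr E 2 2 0
     + sym_corr E 2 2 2 - 2 * sym_corr E 3 3 1 - 2 * sym_corr E 3 3 2"

definition bell_F2 :: "(nat \<Rightarrow> nat \<Rightarrow> nat \<Rightarrow> real) \<Rightarrow> real" where
  "bell_F2 E = 9 + sym_corr E 1 1 0 + 2 * sym_corr E 2 2 0 - 2 * sym_corr E 2 2 1
     - sym_corr E 3 0 0 - sym_corr E 3 1 0 + sym_corr E 3 1 1 - 2 * sym_corr E 3 2 2"

definition bell_F3 :: "(nat \<Rightarrow> nat \<Rightarrow> nat \<Rightarrow> real) \<Rightarrow> real" where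
  "bell_F3 E = 9 - sym_corr E 2 1 0 + sym_corr E 2 1 1 + sym_corr E 2 2 0 + 3 * sym_corr E 2 2 2
     - sym_corr E 3 0 0 - sym_corr E 3 1 0 + sym_corr E 3 1 1 - 2 * sym_corr E 3 2 2"

definition violates_bell_inequality ::
  "((nat \<Rightarrow> nat \<Rightarrow> nat \<Rightarrow> real) \<Rightarrow> real) \<Rightarrow> (qubit \<times> qubit \<times> qubit) operator \<Rightarrow> bool" where
  "violates_bell_inequality F \<rho> \<longleftrightarrow>
     (\<exists>A B C :: nat \<Rightarrow> qubit operator.
        A 0 = mat 1 \<and> B 0 = mat 1 \<and> C 0 = mat 1 \<and>
        (\<forall>i\<in>{1,2,3}. dichotomic_observable (A i) \<and> dichotomic_observable (B i) \<and>
                     dichotomic_observable (C i)) \<and>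
        F (\<lambda>i j k. expectation \<rho> (A i) (B j) (C k)) < 0)"

definition povm :: "nat \<Rightarrow> (nat \<Rightarrow> 'n::finite operator) \<Rightarrow> bool" where
  "povm r M \<longleftrightarrow> (\<forall>a<r. positive_semidefinite (M a)) \<and> (\<Sum>a<r. M a) = mat 1"

text \<open>
  A scenario gives each party a number \<open>m\<close> of settings, and for each setting \<open>x < m\<close> a number
  \<open>r x\<close> of outcomes, which may vary with the setting.  A local deterministic assignment of one
  party picks an outcome for every setting; \<open>p a b c x y z\<close> is the conditional probability
  \<open>p(a,b,c|x,y,z)\<close>.
\<close>

definition assignments :: "nat \<Rightarrow> (nat \<Rightarrow> nat) \<Rightarrow> (nat \<Rightarrow> nat) set" where
  "assignments m r = (\<Pi>\<^sub>E x\<in>{..<m}. {..<r x})"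

definition admits_lhv_model ::
  "nat \<Rightarrow> (nat \<Rightarrow> nat) \<Rightarrow> nat \<Rightarrow> (nat \<Rightarrow> nat) \<Rightarrow> nat \<Rightarrow> (nat \<Rightarrow> nat) \<Rightarrow>
     (nat \<Rightarrow> nat \<Rightarrow> nat \<Rightarrow> nat \<Rightarrow> nat \<Rightarrow> nat \<Rightarrow> real) \<Rightarrow> bool" where
  "admits_lhv_model mA rA mB rB mC rC p \<longleftrightarrow>
     (\<exists>w :: (nat \<Rightarrow> nat) \<times> (nat \<Rightarrow> nat) \<times> (nat \<Rightarrow> nat) \<Rightarrow> real.
        let \<Lambda> = assignments mA rA \<times> assignments mB rB \<times> assignments mC rC in
        (\<forall>l\<in>\<Lambda>. 0 \<le> w l) \<and> (\<Sum>l\<in>\<Lambda>. w l) = 1 \<and>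
        (\<forall>x<mA. \<forall>y<mB. \<forall>z<mC. \<forall>a<rA x. \<forall>b<rB y. \<forall>c<rC z.
           p a b c x y z =
             (\<Sum>(f, g, h)\<in>\<Lambda>. w (f, g, h) * of_bool (f x = a \<and> g y = b \<and> h z = c))))"

definition violates_no_bell_inequality ::
  "nat \<Rightarrow> (nat \<Rightarrow> nat) \<Rightarrow> nat \<Rightarrow> (nat \<Rightarrow> nat) \<Rightarrow> nat \<Rightarrow> (nat \<Rightarrow> nat) \<Rightarrow>
     ('a::finite \<times> 'b::finite \<times> 'c::finite) operator \<Rightarrow> bool" where
  "violates_no_bell_inequality mA rA mB rB mC rC \<rho> \<longleftrightarrow>
     (\<forall>(M :: nat \<Rightarrow> nat \<Rightarrow> 'a operator) (N :: nat \<Rightarrow> nat \<Rightarrow> 'b operator)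
        (P :: nat \<Rightarrow> nat \<Rightarrow> 'c operator).
        (\<forall>x<mA. povm (rA x) (M x)) \<and> (\<forall>y<mB. povm (rB y) (N y)) \<and> (\<forall>z<mC. povm (rC z) (P z)) \<longrightarrow>
        admits_lhv_model mA rA mB rB mC rC
          (\<lambda>a b c x y z. expectation \<rho> (M x a) (N y b) (P z c)))"

end

(*
  In the violating states party B is classical: each one is r * sum_b |b><b| (x) tr_C' |v_b><v_b| with
  vectors v_b on A, C, C' that are symmetric in C, C'.  Copying the label b to B' and keeping C' gives
  a symmetric extension, and the marginals AB and BC are separable because B is classical.  Only the
  marginal AC needs an explicit separable decomposition.  This still suffices for a violation because
  F_n < 0 is reachable with a single nontrivial measurement of B, the other two being constant or,
  up to sign, equal to it.

  The states come from minimising F_n over the observables and H_{ABB'CC'} by semidefinite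
  programming, with positive partial transposes of the marginals as constraints; the optimal v_b and
  observables were rounded to rational ones, and the weights of the product states are a basic
  solution of a linear program.

  A symmetric extension gives an LHV model: the outcomes of the two measurements of B are obtained
  jointly by measuring B and B', and likewise for C; conditioned on these four outcomes, the outcomes
  of A for different settings may be chosen independently.
*)

theory Submission
  imports Defs
begin

section \<open>Positive semidefinite operators\<close>

text \<open>The form with two independent arguments is what makes completing the square possible; on
  the diagonal it is the quadratic form of \<open>positive_semidefinite\<close>.\<close>

definition sesq :: "'n::finite operator \<Rightarrow> complex ^ 'n \<Rightarrow> complex ^ 'n \<Rightarrow> complex" where
  "sesq M u v = (\<Sum>i\<in>UNIV. cnj (u $ i) * (M *v v) $ i)"

definition ketbra :: "complex ^ 'n \<Rightarrow> 'n::finite operator" where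
  "ketbra v = (\<chi> i j. v $ i * cnj (v $ j))"

lemma positive_semidefinite_iff:
  "positive_semidefinite M \<longleftrightarrow> hermitian M \<and> (\<forall>v. 0 \<le> Re (sesq M v v))"
  by (simp add: positive_semidefinite_def sesq_def)

lemma hermitianI: "(\<And>i j. cnj (M $ j $ i) = M $ i $ j) \<Longrightarrow> hermitian M"
  by (simp add: hermitian_def)

lemma hermitian_cnj: "hermitian M \<Longrightarrow> cnj (M $ j $ i) = M $ i $ j"
  unfolding hermitian_def by (drule spec, drule spec, erule sym)

lemma sesq_add_left: "sesq M (u + u') v = sesq M u v + sesq M u' v"
  by (simp add: sesq_def algebra_simps sum.distrib)

lemma sesq_scale_left: "sesq M (c *s u) v = cnj c * sesq M u v"
  by (simp add: sesq_def sum_distrib_left algebra_simps)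

lemma sesq_add_right: "sesq M u (v + v') = sesq M u v + sesq M u v'"
  by (simp add: sesq_def matrix_vector_mult_def algebra_simps sum.distrib)

lemma sesq_scale_right: "sesq M u (c *s v) = c * sesq M u v"
  by (simp add: sesq_def matrix_vector_mult_def sum_distrib_left algebra_simps)

lemma sesq_add_matrix: "sesq (M + N) u v = sesq M u v + sesq N u v"
  by (simp add: sesq_def matrix_vector_mult_add_rdistrib algebra_simps sum.distrib)

lemma sesq_diff_matrix: "sesq (M - N) u v = sesq M u v - sesq N u v"
  by (simp add: sesq_def matrix_vector_mult_def algebra_simps sum_subtractf)

lemma sesq_scaleR_matrix: "sesq (r *\<^sub>R M) u v = r *\<^sub>R sesq M u v"
  by (simp add: sesq_def matrix_vector_mult_def scaleR_sum_right sum_distrib_left)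

lemma sesq_axis_left: "sesq M (axis i 1) v = (M *v v) $ i"
proof -
  have "cnj (axis i 1 $ k) * (M *v v) $ k = (if k = i then (M *v v) $ k else 0)" for k
    by (simp add: axis_def)
  then show ?thesis by (simp add: sesq_def)
qed

lemma sesq_axis: "sesq M (axis i 1) (axis j 1) = M $ i $ j"
  by (subst sesq_axis_left) (simp add: matrix_vector_mult_def axis_def if_distrib cong: if_cong)

lemma sesq_cnj:
  assumes "hermitian M"
  shows "cnj (sesq M u v) = sesq M v u"
proof -
  have h: "cnj (M $ i $ j) = M $ j $ i" for i j
    using assms by (rule hermitian_cnj)
  have "cnj (sesq M u v) = (\<Sum>i\<in>UNIV. \<Sum>j\<in>UNIV. u $ i * (M $ j $ i * cnj (v $ j)))"
    by (simp add: sesq_def matrix_vector_mult_def sum_distrib_left h)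
  also have "\<dots> = (\<Sum>j\<in>UNIV. \<Sum>i\<in>UNIV. u $ i * (M $ j $ i * cnj (v $ j)))"
    by (rule sum.swap)
  also have "\<dots> = sesq M v u"
    by (simp add: sesq_def matrix_vector_mult_def sum_distrib_left algebra_simps)
  finally show ?thesis .
qed

lemma sesq_ketbra:
  "sesq (ketbra w) u v = (\<Sum>i\<in>UNIV. cnj (u $ i) * w $ i) * (\<Sum>j\<in>UNIV. cnj (w $ j) * v $ j)"
  by (simp add: sesq_def ketbra_def matrix_vector_mult_def sum_product)
    (simp add: sum_distrib_left mult.assoc)

lemma hermitian_ketbra: "hermitian (ketbra v)"
  by (simp add: hermitian_def ketbra_def)

lemma positive_semidefinite_ketbra: "positive_semidefinite (ketbra v)"
proof -
  have "sesq (ketbra v) u u = (\<Sum>i\<in>UNIV. cnj (u $ i) * v $ i) * cnj (\<Sum>i\<in>UNIV. cnj (u $ i) * v $ i)"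
    for u by (simp add: sesq_ketbra mult.commute)
  moreover have "0 \<le> Re (z * cnj z)" for z by simp
  ultimately have "0 \<le> Re (sesq (ketbra v) u u)" for u by metis
  then show ?thesis by (simp add: positive_semidefinite_iff hermitian_ketbra)
qed

section \<open>Closure of positivity under sums and nonnegative multiples\<close>

lemma positive_semidefinite_zero: "positive_semidefinite 0"
  by (simp add: positive_semidefinite_def hermitian_def)

lemma hermitian_add: "hermitian M \<Longrightarrow> hermitian N \<Longrightarrow> hermitian (M + N)"
  by (rule hermitianI) (simp add: hermitian_cnj)

lemma hermitian_diff: "hermitian M \<Longrightarrow> hermitian N \<Longrightarrow> hermitian (M - N)"
  by (rule hermitianI) (simp add: hermitian_cnj)

lemma hermitian_scaleR: "hermitian M \<Longrightarrow> hermitian (r *\<^sub>R M)"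
  by (rule hermitianI) (simp add: hermitian_cnj)

lemma positive_semidefinite_add:
  "positive_semidefinite M \<Longrightarrow> positive_semidefinite N \<Longrightarrow> positive_semidefinite (M + N)"
  by (simp add: positive_semidefinite_iff sesq_add_matrix hermitian_add)

lemma positive_semidefinite_scaleR:
  "0 \<le> r \<Longrightarrow> positive_semidefinite M \<Longrightarrow> positive_semidefinite (r *\<^sub>R M)"
  by (simp add: positive_semidefinite_iff sesq_scaleR_matrix hermitian_scaleR)

lemma positive_semidefinite_sum:
  "(\<And>k. k \<in> I \<Longrightarrow> positive_semidefinite (M k)) \<Longrightarrow> positive_semidefinite (\<Sum>k\<in>I. M k)"
  by (induction I rule: infinite_finite_induct)
    (simp_all add: positive_semidefinite_zero positive_semidefinite_add)

section \<open>Decomposition of positive operators into rank-one terms\<close>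

lemma positive_semidefinite_diag:
  assumes "positive_semidefinite M"
  shows "M $ i $ i = of_real (Re (M $ i $ i))" "0 \<le> Re (M $ i $ i)"
proof -
  have h: "hermitian M" and p: "0 \<le> Re (sesq M v v)" for v
    using assms by (auto simp: positive_semidefinite_iff)
  show "M $ i $ i = of_real (Re (M $ i $ i))"
    using hermitian_cnj[OF h] by (metis Reals_cnj_iff of_real_Re)
  show "0 \<le> Re (M $ i $ i)" using p[of "axis i 1"] by (simp add: sesq_axis)
qed

text \<open>A nonzero entry in this row would make the form unbounded below: along a suitable
  multiple of \<open>axis i 1\<close> added to \<open>axis j 1\<close> it has a linear term, but no
  quadratic term because the diagonal entry is zero.\<close>

lemma positive_semidefinite_zero_diag:
  assumes psd: "positive_semidefinite M" and 0: "M $ i $ i = 0"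
  shows "M $ i $ j = 0"
proof (rule ccontr)
  assume nz: "M $ i $ j \<noteq> 0"
  have h: "hermitian M" and p: "0 \<le> Re (sesq M v v)" for v
    using psd by (auto simp: positive_semidefinite_iff)
  have hji: "M $ j $ i = cnj (M $ i $ j)" using hermitian_cnj[OF h] by simp
  define m where "m = (cmod (M $ i $ j))\<^sup>2"
  have m: "m > 0" using nz by (simp add: m_def)
  \<comment> \<open>Solves \<open>- 2 * s * m + Re (M $ j $ j) = -1\<close>, which makes the form
    negative.\<close>
  define s where "s = (Re (M $ j $ j) + 1) / (2 * m)"
  let ?v = "(- of_real s * M $ i $ j) *s axis i 1 + axis j 1"
  have "sesq M ?v ?v = - 2 * of_real s * (M $ i $ j * cnj (M $ i $ j)) + M $ j $ j"
    unfolding sesq_add_left sesq_add_right sesq_scale_left sesq_scale_right sesq_axis 0 hji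
    by simp
  also have "M $ i $ j * cnj (M $ i $ j) = of_real m"
    by (simp only: m_def complex_norm_square)
  finally have "Re (sesq M ?v ?v) = - 2 * s * m + Re (M $ j $ j)" by simp
  also have "\<dots> = -1" using m by (simp add: s_def field_simps)
  finally show False using p[of ?v] by simp
qed

text \<open>One step of Cholesky elimination.\<close>

lemma positive_semidefinite_schur:
  assumes psd: "positive_semidefinite M" and nz: "M $ i $ i \<noteq> 0"
  defines "u \<equiv> (\<chi> k. M $ k $ i / of_real (sqrt (Re (M $ i $ i))))"
  shows "positive_semidefinite (M - ketbra u)" and "(M - ketbra u) $ i $ j = 0"
    and "M $ k $ i = 0 \<Longrightarrow> M $ k $ j = 0 \<Longrightarrow> (M - ketbra u) $ k $ j = 0"
proof -
  have h: "hermitian M" and p: "0 \<le> Re (sesq M v v)" for v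
    using psd by (auto simp: positive_semidefinite_iff)
  have hji: "M $ j $ i = cnj (M $ i $ j)" for i j using hermitian_cnj[OF h] by simp
  define c where "c = Re (M $ i $ i)"
  have Mii: "M $ i $ i = of_real c"
    using positive_semidefinite_diag(1)[OF psd] by (simp add: c_def)
  have c: "c > 0"
    using nz positive_semidefinite_diag(2)[OF psd, of i] Mii by (auto simp: c_def[symmetric] less_le)
  have sq: "complex_of_real (sqrt c) * complex_of_real (sqrt c) = of_real c"
    using c by (simp flip: of_real_mult)
  have ku: "ketbra u $ k $ l = M $ k $ i * cnj (M $ l $ i) / of_real c" for k l
    by (simp add: ketbra_def u_def c_def[symmetric] sq)
  show "(M - ketbra u) $ i $ j = 0"
    using c by (simp add: ku Mii hji[of j i])
  show "M $ k $ i = 0 \<Longrightarrow> M $ k $ j = 0 \<Longrightarrow> (M - ketbra u) $ k $ j = 0"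
    by (simp add: ku)
  have "hermitian (M - ketbra u)"
    using h hermitian_ketbra by (rule hermitian_diff)
  moreover have "0 \<le> Re (sesq (M - ketbra u) v v)" for v
  proof -
    \<comment> \<open>This \<open>?t\<close> minimises the form of \<open>M\<close> on the line
      through \<open>v\<close> in direction \<open>axis i 1\<close>. The minimum is the value at
      \<open>v\<close> of the form of \<open>M - ketbra u\<close>, which is therefore
      nonnegative.\<close>
    let ?t = "- (M *v v) $ i / of_real c"
    have r: "sesq M v (axis i 1) = cnj ((M *v v) $ i)"
      using sesq_cnj[OF h, of "axis i 1" v] by (simp add: sesq_axis_left)
    have "sesq M (v + ?t *s axis i 1) (v + ?t *s axis i 1)
        = sesq M v v + ?t * cnj ((M *v v) $ i) + cnj ?t * (M *v v) $ i + ?t * cnj ?t * of_real c"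
      unfolding sesq_add_left sesq_add_right sesq_scale_left sesq_scale_right sesq_axis r Mii
      unfolding sesq_axis_left by (simp add: algebra_simps)
    also have "\<dots> = sesq M v v - (M *v v) $ i * cnj ((M *v v) $ i) / of_real c"
      using c by (simp add: field_simps)
    also have "(M *v v) $ i * cnj ((M *v v) $ i) / of_real c = sesq (ketbra u) v v"
    proof -
      have "cnj (v $ k) * u $ k = cnj (M $ i $ k * v $ k) / of_real (sqrt c)"
        "cnj (u $ k) * v $ k = M $ i $ k * v $ k / of_real (sqrt c)" for k
        by (simp_all add: u_def c_def[symmetric] hji[of i k])
      then have a: "(\<Sum>k\<in>UNIV. cnj (v $ k) * u $ k) = cnj ((M *v v) $ i) / of_real (sqrt c)"
        and b: "(\<Sum>k\<in>UNIV. cnj (u $ k) * v $ k) = (M *v v) $ i / of_real (sqrt c)"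
        by (simp_all only: matrix_vector_mult_def sum_divide_distrib vec_lambda_beta cnj_sum)
      show ?thesis unfolding sesq_ketbra a b by (simp add: sq)
    qed
    finally show ?thesis using p by (metis sesq_diff_matrix)
  qed
  ultimately show "positive_semidefinite (M - ketbra u)" by (simp add: positive_semidefinite_iff)
qed

text \<open>Induction on a finite set of indices outside of which all rows vanish. An index with
  zero diagonal entry has a zero row already; any other index is removed by a Cholesky step, which
  keeps the zero rows and splits off one vector.\<close>

lemma positive_semidefinite_eq_sum_ketbra:
  fixes M :: "'n::finite operator"
  assumes "positive_semidefinite M"
  obtains K and u :: "nat \<Rightarrow> complex ^ 'n" where "M = (\<Sum>k<K. ketbra (u k))"
proof -
  have "\<exists>K u. M = (\<Sum>k<(K::nat). ketbra (u k))"
    if "finite S" "positive_semidefinite M" "\<And>i j. i \<notin> S \<Longrightarrow> M $ i $ j = 0"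
    for S and M :: "'n operator"
    using that
  proof (induction S arbitrary: M rule: finite_induct)
    case empty
    \<comment> \<open>All rows vanish, so the empty sum represents \<open>M\<close> and the family
      of vectors is arbitrary.\<close>
    then have "M = (\<Sum>k<(0::nat). ketbra (undefined k))" by (simp add: vec_eq_iff)
    then show ?case by blast
  next
    case (insert i S)
    show ?case
    proof (cases "M $ i $ i = 0")
      case True
      show ?thesis
      proof (rule insert.IH[OF insert.prems(1)])
        fix k j assume "k \<notin> S"
        then show "M $ k $ j = 0"
          using insert.prems(2)[of k j] positive_semidefinite_zero_diag[OF insert.prems(1) True]
          by (cases "k = i") auto
      qed
    next
      case False
      let ?u = "\<chi> k. M $ k $ i / of_real (sqrt (Re (M $ i $ i)))"
      note sc = positive_semidefinite_schur[OF insert.prems(1) False]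
      have "\<exists>K u. M - ketbra ?u = (\<Sum>k<(K::nat). ketbra (u k))"
      proof (rule insert.IH[OF sc(1)])
        fix k j assume "k \<notin> S"
        then show "(M - ketbra ?u) $ k $ j = 0"
          using sc(2)[of j] sc(3)[of k j] insert.prems(2)[of k] by (cases "k = i") auto
      qed
      then obtain K u where "M - ketbra ?u = (\<Sum>k<(K::nat). ketbra (u k))" by blast
      then have "M = (\<Sum>k<K. ketbra (u k)) + ketbra ?u" by (metis diff_add_cancel)
      also have "\<dots> = (\<Sum>k<Suc K. ketbra ((u(K := ?u)) k))" by simp
      finally show ?thesis by blast
    qed
  qed
  from this[of UNIV, OF _ assms] that show thesis by auto
qed

section \<open>Tensor products and traces of products of positive operators\<close>

lemma tensor_sum_left: "tensor (\<Sum>k\<in>I. M k) N = (\<Sum>k\<in>I. tensor (M k) N)"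
  by (simp add: vec_eq_iff tensor_def sum_distrib_right)

lemma tensor_sum_right: "tensor M (\<Sum>k\<in>I. N k) = (\<Sum>k\<in>I. tensor M (N k))"
  by (simp add: vec_eq_iff tensor_def sum_distrib_left)

lemma tensor_ketbra: "tensor (ketbra u) (ketbra v) = ketbra (\<chi> i. u $ fst i * v $ snd i)"
  by (simp add: vec_eq_iff tensor_def ketbra_def)

lemma tensor_mat_1: "tensor (mat 1) (mat 1) = mat 1"
  by (auto simp add: vec_eq_iff tensor_def mat_def prod_eq_iff)

text \<open>By bilinearity it is enough to treat rank-one factors, and their tensor product is again
  of rank one, with the product vector.\<close>

lemma positive_semidefinite_tensor:
  assumes "positive_semidefinite M" "positive_semidefinite N"
  shows "positive_semidefinite (tensor M N)"
proof -
  obtain K :: nat and u where "M = (\<Sum>k<K. ketbra (u k))"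
    using positive_semidefinite_eq_sum_ketbra[OF assms(1)] .
  moreover obtain L :: nat and v where "N = (\<Sum>l<L. ketbra (v l))"
    using positive_semidefinite_eq_sum_ketbra[OF assms(2)] .
  ultimately show ?thesis
    by (simp add: tensor_sum_left tensor_sum_right tensor_ketbra
        positive_semidefinite_sum positive_semidefinite_ketbra)
qed

lemma positive_semidefinite_mat_1: "positive_semidefinite (mat 1 :: 'a::finite operator)"
proof -
  have "ketbra (axis k 1) $ i $ j = (if k = i then mat 1 $ i $ j else 0)" for k i j :: 'a
    by (auto simp: ketbra_def axis_def mat_def)
  then have "mat 1 = (\<Sum>k\<in>UNIV. ketbra (axis k (1::complex) :: complex ^ 'a))"
    by (simp add: vec_eq_iff)
  then show ?thesis by (simp add: positive_semidefinite_sum positive_semidefinite_ketbra)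
qed

lemma matrix_mult_zero_right: "A ** (0 :: 'n::finite operator) = 0"
  by (simp add: vec_eq_iff matrix_matrix_mult_def)

lemma trace_mult_sum_right: "trace (A ** (\<Sum>k\<in>I. B k)) = (\<Sum>k\<in>I. trace (A ** B k))"
  by (induction I rule: infinite_finite_induct)
    (simp_all add: matrix_add_ldistrib matrix_mult_zero_right, simp_all add: trace_def sum.distrib)

lemma trace_mult_ketbra: "trace (A ** ketbra v) = sesq A v v"
  by (simp add: trace_def matrix_matrix_mult_def ketbra_def sesq_def matrix_vector_mult_def
      sum_distrib_left algebra_simps)

text \<open>Decomposing only \<open>B\<close> turns the trace into a sum of values of the quadratic
  form of \<open>A\<close>. This is the source of nonnegative probabilities below.\<close>

lemma trace_mult_nonneg:
  assumes "positive_semidefinite A" "positive_semidefinite B"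
  shows "0 \<le> Re (trace (A ** B))"
proof -
  obtain K u where "B = (\<Sum>k<(K::nat). ketbra (u k))"
    using positive_semidefinite_eq_sum_ketbra[OF assms(2)] .
  then show ?thesis
    using assms(1) by (auto simp: trace_mult_sum_right trace_mult_ketbra positive_semidefinite_iff
        intro!: sum_nonneg)
qed

section \<open>LHV models from symmetric extensions\<close>

text \<open>For POVM elements this is the joint outcome probability when all five factors of
  \<open>H\<close> are measured, in the order A, B, B', C, C'.\<close>

definition extension_value ::
  "('a::finite \<times> 'b::finite \<times> 'b \<times> 'c::finite \<times> 'c) operator \<Rightarrow>
     'a operator \<Rightarrow> 'b operator \<Rightarrow> 'b operator \<Rightarrow> 'c operator \<Rightarrow> 'c operator \<Rightarrow> real" where
  "extension_value H M N N' P P' =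
     Re (trace (H ** tensor M (tensor N (tensor N' (tensor P P')))))"

lemma extension_value_nonneg:
  assumes "positive_semidefinite H" "positive_semidefinite M" "positive_semidefinite N"
    "positive_semidefinite N'" "positive_semidefinite P" "positive_semidefinite P'"
  shows "0 \<le> extension_value H M N N' P P'"
  unfolding extension_value_def
  by (intro trace_mult_nonneg positive_semidefinite_tensor assms)

lemma extension_value_sum:
  "extension_value H (\<Sum>k\<in>I. M' k) N N' P P' = (\<Sum>k\<in>I. extension_value H (M' k) N N' P P')"
  "extension_value H M (\<Sum>k\<in>I. N0 k) N' P P' = (\<Sum>k\<in>I. extension_value H M (N0 k) N' P P')"
  "extension_value H M N (\<Sum>k\<in>I. N0 k) P P' = (\<Sum>k\<in>I. extension_value H M N (N0 k) P P')"
  "extension_value H M N N' (\<Sum>k\<in>I. P0 k) P' = (\<Sum>k\<in>I. extension_value H M N N' (P0 k) P')"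
  "extension_value H M N N' P (\<Sum>k\<in>I. P0 k) = (\<Sum>k\<in>I. extension_value H M N N' P (P0 k))"
  by (simp_all only: extension_value_def tensor_sum_left tensor_sum_right trace_mult_sum_right Re_sum)

section \<open>Exchange symmetry and partial trace of the five-party values\<close>

lemma trace_mult_eq: "trace (A ** B) = (\<Sum>i\<in>UNIV. \<Sum>j\<in>UNIV. A $ i $ j * B $ j $ i)"
  by (simp add: trace_def matrix_matrix_mult_def)

text \<open>Relabelling the basis by \<pi> conjugates both operators by the same permutation matrix.
  The exchanges of B with B' and of C with C' are of this kind.\<close>

lemma trace_mult_permute:
  assumes "bij \<pi>" and "\<And>i j. A' $ i $ j = A $ \<pi> i $ \<pi> j" and "\<And>i j. B' $ i $ j = B $ \<pi> i $ \<pi> j"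
  shows "trace (A' ** B') = trace (A ** B)"
  unfolding trace_mult_eq assms(2,3)
  by (simp add: sum.reindex_bij_betw[OF assms(1), of "\<lambda>j. A $ _ $ j * B $ j $ _"]
      sum.reindex_bij_betw[OF assms(1), of "\<lambda>i. \<Sum>j\<in>UNIV. A $ i $ j * B $ j $ i"])

lemma extension_value_swap_BB':
  assumes "swap_BB' H = H"
  shows "extension_value H M N' N P P' = extension_value H M N N' P P'"
proof -
  let ?\<pi> = "\<lambda>(a, b, b', c, c'). (a, b', b, c, c')"
  have "bij ?\<pi>" by (rule o_bij[of ?\<pi>]) auto
  moreover have "H $ i $ j = H $ ?\<pi> i $ ?\<pi> j" for i j
    by (subst assms[symmetric]) (simp add: swap_BB'_def split: prod.split)
  ultimately show ?thesis
    unfolding extension_value_def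
    by (intro arg_cong[where f = Re] trace_mult_permute[where \<pi> = ?\<pi>])
      (auto simp: tensor_def split: prod.split)
qed

lemma extension_value_swap_CC':
  assumes "swap_CC' H = H"
  shows "extension_value H M N N' P' P = extension_value H M N N' P P'"
proof -
  let ?\<pi> = "\<lambda>(a, b, b', c, c'). (a, b, b', c', c)"
  have "bij ?\<pi>" by (rule o_bij[of ?\<pi>]) auto
  moreover have "H $ i $ j = H $ ?\<pi> i $ ?\<pi> j" for i j
    by (subst assms[symmetric]) (simp add: swap_CC'_def split: prod.split)
  ultimately show ?thesis
    unfolding extension_value_def
    by (intro arg_cong[where f = Re] trace_mult_permute[where \<pi> = ?\<pi>])
      (auto simp: tensor_def split: prod.split)
qed

lemma sum_UNIV_prod:
  "(\<Sum>x\<in>(UNIV :: ('a::finite \<times> 'b::finite) set). f x) = (\<Sum>a\<in>UNIV. \<Sum>b\<in>UNIV. f (a, b))"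
  by (simp add: sum.cartesian_product)

text \<open>The two deltas are the entries of the identities on B' and C' in
  \<open>extension_value_marginal\<close>.\<close>

lemma sum_delta_delta:
  fixes K :: "'i::finite \<Rightarrow> complex"
  shows "(\<Sum>(e, f, j)\<in>(UNIV :: ('b::finite \<times> 'c::finite \<times> 'i) set).
    if e = b then if f = c then K j else 0 else 0) = (\<Sum>j\<in>UNIV. K j)"
proof -
  have "(\<Sum>j\<in>UNIV. if e = b then if f = c then K j else 0 else 0)
      = (if e = b then if f = c then \<Sum>j\<in>UNIV. K j else 0 else 0)" for e :: 'b and f :: 'c
    by simp
  moreover have "(\<Sum>f\<in>UNIV. if e = b then if f = c then \<Sum>j\<in>UNIV. K j else 0 else 0)
      = (if e = b then \<Sum>j\<in>UNIV. K j else 0)" for e :: 'b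
    by simp
  ultimately show ?thesis by (simp add: sum_UNIV_prod)
qed

lemma sum_swap_3: "(\<Sum>a\<in>A. \<Sum>b\<in>B. \<Sum>c\<in>C. f a b c) = (\<Sum>c\<in>C. \<Sum>a\<in>A. \<Sum>b\<in>B. f a b c)"
proof -
  have "(\<Sum>a\<in>A. \<Sum>b\<in>B. \<Sum>c\<in>C. f a b c) = (\<Sum>a\<in>A. \<Sum>c\<in>C. \<Sum>b\<in>B. f a b c)"
    by (intro sum.cong refl sum.swap)
  also have "\<dots> = (\<Sum>c\<in>C. \<Sum>a\<in>A. \<Sum>b\<in>B. f a b c)" by (rule sum.swap)
  finally show ?thesis .
qed

text \<open>The identities force row and column to agree in the B' and C' indices, which is exactly
  the partial trace.\<close>

lemma extension_value_marginal:
  "extension_value H M N (mat 1) P (mat 1) = expectation (trace_B'C' H) M N P"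
proof -
  let ?X = "\<lambda>i j :: 'a \<times> 'b \<times> 'c. M $ fst j $ fst i * (N $ fst (snd j) $ fst (snd i) * P $ snd (snd j) $ snd (snd i))"
  let ?H = "\<lambda>b' c' i j. H $ (fst i, fst (snd i), b', snd (snd i), c') $ (fst j, fst (snd j), b', snd (snd j), c')"
  \<comment> \<open>Moves the indices of B' and C' to the front, so that the deltas can be summed
    first.\<close>
  let ?g = "\<lambda>(a, b, b', c, c'). (b', c', a, b, c)"
  have "trace (H ** tensor M (tensor N (tensor (mat 1) (tensor P (mat 1)))))
    = (\<Sum>(b', c', i)\<in>UNIV. \<Sum>(e', f', j)\<in>UNIV. if e' = b' then if f' = c' then ?H b' c' i j * ?X i j else 0 else 0)"
    unfolding trace_mult_eq
  proof (rule sum.reindex_bij_witness[where i = "\<lambda>(b', c', a, b, c). (a, b, b', c, c')" and j = ?g],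
      goal_cases)
    case (5 i)
    obtain a b b' c c' where i: "i = (a, b, b', c, c')" by (cases i)
    show ?case unfolding i prod.case
      by (rule sym, rule sum.reindex_bij_witness[where i = "\<lambda>(b', c', a, b, c). (a, b, b', c, c')" and j = ?g])
        (auto simp: tensor_def mat_def split: prod.split)
  qed auto
  also have "\<dots> = (\<Sum>b'\<in>UNIV. \<Sum>c'\<in>UNIV. \<Sum>i\<in>UNIV. \<Sum>j\<in>UNIV. ?H b' c' i j * ?X i j)"
    by (simp only: sum_delta_delta) (simp only: sum_UNIV_prod prod.case)
  also have "\<dots> = (\<Sum>i\<in>UNIV. \<Sum>j\<in>UNIV. \<Sum>b'\<in>UNIV. \<Sum>c'\<in>UNIV. ?H b' c' i j * ?X i j)"
    by (subst sum_swap_3, rule sum.cong, rule refl, rule sum_swap_3)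
  also have "\<dots> = trace (trace_B'C' H ** tensor3 M N P)"
    unfolding trace_mult_eq by (simp add: tensor3_def tensor_def trace_B'C'_def sum_distrib_right split_def)
  finally show ?thesis by (simp add: extension_value_def expectation_def)
qed

section \<open>Sums over local deterministic assignments\<close>

lemma sum_assignments_2:
  "(\<Sum>g\<in>assignments 2 r. \<phi> (g 0) (g 1)) = (\<Sum>u<r 0. \<Sum>v<r 1. \<phi> u v)"
proof -
  \<comment> \<open>Assignments are extensional functions, hence the restriction: outside of the two
    settings the value has to be \<open>undefined\<close>.\<close>
  let ?i = "\<lambda>(u, v). \<lambda>x\<in>{..<2::nat}. if x = 0 then u else v :: nat"
  have 2: "x = 0 \<or> x = 1" if "x < 2" for x :: nat using that by linarith
  have "(\<Sum>g\<in>assignments 2 r. \<phi> (g 0) (g 1)) = (\<Sum>p\<in>{..<r 0} \<times> {..<r 1}. \<phi> (fst p) (snd p))"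
  proof (rule sum.reindex_bij_witness[where j = "\<lambda>g. (g 0, g 1)" and i = ?i])
    fix g assume g: "g \<in> assignments 2 r"
    show "(g 0, g 1) \<in> {..<r 0} \<times> {..<r 1}"
      using PiE_mem[OF g[unfolded assignments_def], of 0] PiE_mem[OF g[unfolded assignments_def], of 1]
      by simp
    have "?i (g 0, g 1) x = g x" for x
    proof (cases "x < 2")
      case True
      show ?thesis using 2[OF True] by (elim disjE; simp)
    next
      case False
      then show ?thesis using PiE_arb[OF g[unfolded assignments_def], of x] by simp
    qed
    then show "?i (g 0, g 1) = g" by (rule ext)
  next
    fix p assume p: "p \<in> {..<r 0} \<times> {..<r 1}"
    show "?i p \<in> assignments 2 r"
      unfolding assignments_def
    proof (rule PiE_I)
      fix x :: nat assume "x \<in> {..<2}"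
      then have "x = 0 \<or> x = 1" using 2 by simp
      then show "?i p x \<in> {..<r x}" using p by (cases p; elim disjE; simp)
    qed (use p in \<open>cases p; simp\<close>)
  qed (auto simp: split_def)
  also have "\<dots> = (\<Sum>u<r 0. \<Sum>v<r 1. \<phi> u v)"
    by (simp add: sum.cartesian_product split_def)
  finally show ?thesis .
qed

text \<open>A pair of outcomes answers setting \<open>y\<close> with its component number
  \<open>y\<close>. The surviving sum runs over the outcomes of the other setting and is later
  absorbed by the completeness of its POVM.\<close>

lemma sum_pair_delta:
  fixes \<phi> :: "nat \<Rightarrow> nat \<Rightarrow> real" and y :: nat
  assumes "y < 2" "b < r y"
  shows "(\<Sum>u<r 0. \<Sum>v<r 1. if (if y = 0 then u else v) = b then \<phi> u v else 0)
    = (if y = 0 then \<Sum>v<r 1. \<phi> b v else \<Sum>u<r 0. \<phi> u b)"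
proof (cases "y = 0")
  case True
  then have "(\<Sum>u<r 0. \<Sum>v<r 1. if (if y = 0 then u else v) = b then \<phi> u v else 0)
      = (\<Sum>u<r 0. if u = b then \<Sum>v<r 1. \<phi> b v else 0)"
    by (intro sum.cong) auto
  also have "\<dots> = (\<Sum>v<r 1. \<phi> b v)" using True assms(2) by simp
  finally show ?thesis using True by simp
next
  case False
  then have "b < r 1" using assms by (metis less_2_cases One_nat_def)
  from False have "(\<Sum>u<r 0. \<Sum>v<r 1. if (if y = 0 then u else v) = b then \<phi> u v else 0)
      = (\<Sum>u<r 0. \<Sum>v<r 1. if v = b then \<phi> u b else 0)"
    by (intro sum.cong) auto
  also have "\<dots> = (\<Sum>u<r 0. \<phi> u b)" using \<open>b < r 1\<close> by simp
  finally show ?thesis using False by simp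
qed

lemma sum_assignments_prod:
  fixes \<kappa> :: "nat \<Rightarrow> nat \<Rightarrow> real"
  shows "(\<Sum>f\<in>assignments m r. \<Prod>x<m. \<kappa> x (f x)) = (\<Prod>x<m. \<Sum>a<r x. \<kappa> x a)"
  unfolding assignments_def by (simp add: prod_sum_PiE)

text \<open>The indicator is absorbed into the factor at \<open>y\<close>, so the sum still
  factorises, and every other factor sums to one.\<close>

lemma sum_assignments_prod_marginal:
  fixes \<kappa> :: "nat \<Rightarrow> nat \<Rightarrow> real"
  assumes "\<And>x. x < m \<Longrightarrow> (\<Sum>a<r x. \<kappa> x a) = 1" and "y < m" and "b < r y"
  shows "(\<Sum>f\<in>assignments m r. (\<Prod>x<m. \<kappa> x (f x)) * of_bool (f y = b)) = \<kappa> y b"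
proof -
  let ?\<kappa> = "\<lambda>x a. if x = y then \<kappa> x a * of_bool (a = b) else \<kappa> x a"
  have "(\<Prod>x<m. \<kappa> x (f x)) * of_bool (f y = b) = (\<Prod>x<m. ?\<kappa> x (f x))" for f
  proof -
    have "(\<Prod>x<m. ?\<kappa> x (f x)) = ?\<kappa> y (f y) * (\<Prod>x\<in>{..<m} - {y}. ?\<kappa> x (f x))"
      using assms(2) by (intro prod.remove) auto
    also have "(\<Prod>x\<in>{..<m} - {y}. ?\<kappa> x (f x)) = (\<Prod>x\<in>{..<m} - {y}. \<kappa> x (f x))"
      by (rule prod.cong) auto
    also have "?\<kappa> y (f y) * \<dots> = \<kappa> y (f y) * (\<Prod>x\<in>{..<m} - {y}. \<kappa> x (f x)) * of_bool (f y = b)"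
      by simp
    also have "\<kappa> y (f y) * (\<Prod>x\<in>{..<m} - {y}. \<kappa> x (f x)) = (\<Prod>x<m. \<kappa> x (f x))"
      using assms(2) by (intro prod.remove[symmetric]) auto
    finally show ?thesis by simp
  qed
  then have "(\<Sum>f\<in>assignments m r. (\<Prod>x<m. \<kappa> x (f x)) * of_bool (f y = b))
      = (\<Prod>x<m. \<Sum>a<r x. ?\<kappa> x a)"
    using sum_assignments_prod[where \<kappa> = ?\<kappa>] by simp
  also have "\<dots> = (\<Sum>a<r y. ?\<kappa> y a) * (\<Prod>x\<in>{..<m} - {y}. \<Sum>a<r x. ?\<kappa> x a)"
    using assms(2) by (intro prod.remove) auto
  also have "(\<Prod>x\<in>{..<m} - {y}. \<Sum>a<r x. ?\<kappa> x a) = 1"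
    by (rule prod.neutral) (auto simp: assms(1))
  also have "(\<Sum>a<r y. ?\<kappa> y a) = \<kappa> y b"
  proof -
    have "?\<kappa> y a = (if a = b then \<kappa> y b else 0)" for a by simp
    then show ?thesis using assms(3) by simp
  qed
  finally show ?thesis by simp
qed

section \<open>The local model built from a symmetric extension\<close>

lemma symmetric_extension_imp_violates_no_bell_inequality:
  fixes \<rho> :: "('a::finite \<times> 'b::finite \<times> 'c::finite) operator"
  assumes "symmetric_extension H \<rho>"
  shows "violates_no_bell_inequality mA rA 2 rB 2 rC \<rho>"
  unfolding violates_no_bell_inequality_def
proof (intro allI impI, elim conjE)
  fix M :: "nat \<Rightarrow> nat \<Rightarrow> 'a operator" and N :: "nat \<Rightarrow> nat \<Rightarrow> 'b operator"
    and P :: "nat \<Rightarrow> nat \<Rightarrow> 'c operator"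
  assume "\<forall>x<mA. povm (rA x) (M x)" "\<forall>y<2. povm (rB y) (N y)" "\<forall>z<2. povm (rC z) (P z)"
  then have M: "\<And>x a. x < mA \<Longrightarrow> a < rA x \<Longrightarrow> positive_semidefinite (M x a)"
      "\<And>x. x < mA \<Longrightarrow> (\<Sum>a<rA x. M x a) = mat 1"
    and N: "\<And>y b. y < 2 \<Longrightarrow> b < rB y \<Longrightarrow> positive_semidefinite (N y b)"
      "\<And>y. y < 2 \<Longrightarrow> (\<Sum>b<rB y. N y b) = mat 1"
    and P: "\<And>z c. z < 2 \<Longrightarrow> c < rC z \<Longrightarrow> positive_semidefinite (P z c)"
      "\<And>z. z < 2 \<Longrightarrow> (\<Sum>c<rC z. P z c) = mat 1"
    by (auto simp: povm_def)
  have NP: "(\<Sum>b<rB 0. N 0 b) = mat 1" "(\<Sum>b<rB 1. N 1 b) = mat 1"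
      "(\<Sum>c<rC 0. P 0 c) = mat 1" "(\<Sum>c<rC 1. P 1 c) = mat 1"
    by (rule N P; simp)+
  have H: "positive_semidefinite H" "trace H = 1" "swap_BB' H = H" "swap_CC' H = H"
      "trace_B'C' H = \<rho>"
    using assms by (auto simp: symmetric_extension_def density_operator_def)
  define q where "q x a b\<^sub>0 b\<^sub>1 c\<^sub>0 c\<^sub>1 =
    extension_value H (M x a) (N 0 b\<^sub>0) (N 1 b\<^sub>1) (P 0 c\<^sub>0) (P 1 c\<^sub>1)" for x a b\<^sub>0 b\<^sub>1 c\<^sub>0 c\<^sub>1
  define s where "s b\<^sub>0 b\<^sub>1 c\<^sub>0 c\<^sub>1 =
    extension_value H (mat 1) (N 0 b\<^sub>0) (N 1 b\<^sub>1) (P 0 c\<^sub>0) (P 1 c\<^sub>1)" for b\<^sub>0 b\<^sub>1 c\<^sub>0 c\<^sub>1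
  have q_nonneg: "0 \<le> q x a b\<^sub>0 b\<^sub>1 c\<^sub>0 c\<^sub>1"
    if "x < mA" "a < rA x" "b\<^sub>0 < rB 0" "b\<^sub>1 < rB 1" "c\<^sub>0 < rC 0" "c\<^sub>1 < rC 1" for x a b\<^sub>0 b\<^sub>1 c\<^sub>0 c\<^sub>1
    unfolding q_def using that by (intro extension_value_nonneg H M N P) auto
  have s_nonneg: "0 \<le> s b\<^sub>0 b\<^sub>1 c\<^sub>0 c\<^sub>1"
    if "b\<^sub>0 < rB 0" "b\<^sub>1 < rB 1" "c\<^sub>0 < rC 0" "c\<^sub>1 < rC 1" for b\<^sub>0 b\<^sub>1 c\<^sub>0 c\<^sub>1
    unfolding s_def using that
    by (intro extension_value_nonneg H N P positive_semidefinite_mat_1) auto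
  \<comment> \<open>By completeness of the POVMs of A the sum is independent of \<open>x\<close>, so
    all settings of A can be conditioned on the same distribution \<open>s\<close>.\<close>
  have q_sum: "(\<Sum>a<rA x. q x a b\<^sub>0 b\<^sub>1 c\<^sub>0 c\<^sub>1) = s b\<^sub>0 b\<^sub>1 c\<^sub>0 c\<^sub>1" if "x < mA" for x b\<^sub>0 b\<^sub>1 c\<^sub>0 c\<^sub>1
    unfolding q_def s_def by (simp flip: extension_value_sum add: M(2)[OF that])
  \<comment> \<open>Given the four outcomes on B, B', C, C', the outcomes of A are drawn
    independently for each setting, with conditional probabilities \<open>q / s\<close>. If
    \<open>s\<close> vanishes, the leading factor makes the weight zero whatever the quotients
    are.\<close>
  define W where "W f b\<^sub>0 b\<^sub>1 c\<^sub>0 c\<^sub>1 = s b\<^sub>0 b\<^sub>1 c\<^sub>0 c\<^sub>1 *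
    (\<Prod>x<mA. q x (f x) b\<^sub>0 b\<^sub>1 c\<^sub>0 c\<^sub>1 / s b\<^sub>0 b\<^sub>1 c\<^sub>0 c\<^sub>1)" for f b\<^sub>0 b\<^sub>1 c\<^sub>0 c\<^sub>1
  have W_nonneg: "0 \<le> W f b\<^sub>0 b\<^sub>1 c\<^sub>0 c\<^sub>1"
    if "f \<in> assignments mA rA" "b\<^sub>0 < rB 0" "b\<^sub>1 < rB 1" "c\<^sub>0 < rC 0" "c\<^sub>1 < rC 1" for f b\<^sub>0 b\<^sub>1 c\<^sub>0 c\<^sub>1
    unfolding W_def using that
    by (intro mult_nonneg_nonneg prod_nonneg divide_nonneg_nonneg q_nonneg s_nonneg)
      (auto simp: assignments_def)
  have q_div_sum: "(\<Sum>a<rA x. q x a b\<^sub>0 b\<^sub>1 c\<^sub>0 c\<^sub>1 / s b\<^sub>0 b\<^sub>1 c\<^sub>0 c\<^sub>1) = 1"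
    if "x < mA" "s b\<^sub>0 b\<^sub>1 c\<^sub>0 c\<^sub>1 \<noteq> 0" for x b\<^sub>0 b\<^sub>1 c\<^sub>0 c\<^sub>1
    using that q_sum[OF that(1)] by (simp flip: sum_divide_distrib)
  have W_sum: "(\<Sum>f\<in>assignments mA rA. W f b\<^sub>0 b\<^sub>1 c\<^sub>0 c\<^sub>1) = s b\<^sub>0 b\<^sub>1 c\<^sub>0 c\<^sub>1" for b\<^sub>0 b\<^sub>1 c\<^sub>0 c\<^sub>1
    using sum_assignments_prod[where \<kappa> = "\<lambda>x a. q x a b\<^sub>0 b\<^sub>1 c\<^sub>0 c\<^sub>1 / s b\<^sub>0 b\<^sub>1 c\<^sub>0 c\<^sub>1" and m = mA and r = rA]
      q_div_sum[of _ b\<^sub>0 b\<^sub>1 c\<^sub>0 c\<^sub>1]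
    by (cases "s b\<^sub>0 b\<^sub>1 c\<^sub>0 c\<^sub>1 = 0") (simp_all add: W_def flip: sum_distrib_left)
  have W_marginal: "(\<Sum>f\<in>assignments mA rA. W f b\<^sub>0 b\<^sub>1 c\<^sub>0 c\<^sub>1 * of_bool (f x = a)) = q x a b\<^sub>0 b\<^sub>1 c\<^sub>0 c\<^sub>1"
    if "x < mA" "a < rA x" "b\<^sub>0 < rB 0" "b\<^sub>1 < rB 1" "c\<^sub>0 < rC 0" "c\<^sub>1 < rC 1" for x a b\<^sub>0 b\<^sub>1 c\<^sub>0 c\<^sub>1
  proof (cases "s b\<^sub>0 b\<^sub>1 c\<^sub>0 c\<^sub>1 = 0")
    case True
    \<comment> \<open>These nonnegative numbers sum to \<open>s\<close> over the outcomes of setting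
      \<open>x\<close>, so \<open>s = 0\<close> forces each of them to vanish.\<close>
    have "q x a b\<^sub>0 b\<^sub>1 c\<^sub>0 c\<^sub>1 = 0"
      using q_sum[OF that(1), of b\<^sub>0 b\<^sub>1 c\<^sub>0 c\<^sub>1] True that
        sum_nonneg_eq_0_iff[of "{..<rA x}" "\<lambda>a. q x a b\<^sub>0 b\<^sub>1 c\<^sub>0 c\<^sub>1"] q_nonneg by auto
    then show ?thesis using True by (simp add: W_def)
  next
    case False
    then show ?thesis
      using sum_assignments_prod_marginal[where \<kappa> = "\<lambda>x a. q x a b\<^sub>0 b\<^sub>1 c\<^sub>0 c\<^sub>1 / s b\<^sub>0 b\<^sub>1 c\<^sub>0 c\<^sub>1"
          and m = mA and r = rA and y = x and b = a] q_div_sum[of _ b\<^sub>0 b\<^sub>1 c\<^sub>0 c\<^sub>1] that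
      by (simp add: W_def mult.assoc flip: sum_distrib_left)
  qed
  let ?\<Lambda> = "assignments mA rA \<times> assignments 2 rB \<times> assignments 2 rC"
  define w where "w = (\<lambda>(f, g, h). W f (g (0::nat)) (g 1) (h (0::nat)) (h 1))"
  have sum_\<Lambda>: "(\<Sum>(f, g, h)\<in>?\<Lambda>. \<phi> f (g 0) (g 1) (h 0) (h 1))
      = (\<Sum>b\<^sub>0<rB 0. \<Sum>b\<^sub>1<rB 1. \<Sum>c\<^sub>0<rC 0. \<Sum>c\<^sub>1<rC 1. \<Sum>f\<in>assignments mA rA. \<phi> f b\<^sub>0 b\<^sub>1 c\<^sub>0 c\<^sub>1)"
    for \<phi> :: "(nat \<Rightarrow> nat) \<Rightarrow> nat \<Rightarrow> nat \<Rightarrow> nat \<Rightarrow> nat \<Rightarrow> real"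
  proof -
    have "(\<Sum>(f, g, h)\<in>?\<Lambda>. \<phi> f (g 0) (g 1) (h 0) (h 1)) =
        (\<Sum>f\<in>assignments mA rA. \<Sum>(g, h)\<in>assignments 2 rB \<times> assignments 2 rC. \<phi> f (g 0) (g 1) (h 0) (h 1))"
      by (simp add: sum.cartesian_product split_def)
    also have "\<dots> = (\<Sum>(g, h)\<in>assignments 2 rB \<times> assignments 2 rC. \<Sum>f\<in>assignments mA rA. \<phi> f (g 0) (g 1) (h 0) (h 1))"
      by (subst sum.swap) (simp add: split_def)
    also have "\<dots> = (\<Sum>g\<in>assignments 2 rB. \<Sum>h\<in>assignments 2 rC. \<Sum>f\<in>assignments mA rA. \<phi> f (g 0) (g 1) (h 0) (h 1))"
      by (rule sum.cartesian_product[symmetric])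
    also have "\<dots> = (\<Sum>b\<^sub>0<rB 0. \<Sum>b\<^sub>1<rB 1. \<Sum>h\<in>assignments 2 rC. \<Sum>f\<in>assignments mA rA. \<phi> f b\<^sub>0 b\<^sub>1 (h 0) (h 1))"
      by (rule sum_assignments_2)
    also have "\<dots> = (\<Sum>b\<^sub>0<rB 0. \<Sum>b\<^sub>1<rB 1. \<Sum>c\<^sub>0<rC 0. \<Sum>c\<^sub>1<rC 1. \<Sum>f\<in>assignments mA rA. \<phi> f b\<^sub>0 b\<^sub>1 c\<^sub>0 c\<^sub>1)"
      by (intro sum.cong refl sum_assignments_2)
    finally show ?thesis .
  qed
  have "0 \<le> w l" if "l \<in> ?\<Lambda>" for l
    using that by (auto simp: w_def assignments_def PiE_iff intro!: W_nonneg)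
  moreover have "(\<Sum>l\<in>?\<Lambda>. w l) = 1"
  proof -
    have "(\<Sum>l\<in>?\<Lambda>. w l) = (\<Sum>b\<^sub>0<rB 0. \<Sum>b\<^sub>1<rB 1. \<Sum>c\<^sub>0<rC 0. \<Sum>c\<^sub>1<rC 1. s b\<^sub>0 b\<^sub>1 c\<^sub>0 c\<^sub>1)"
      unfolding w_def sum_\<Lambda> W_sum ..
    also have "\<dots> = extension_value H (mat 1) (mat 1) (mat 1) (mat 1) (mat 1)"
    proof -
      have "s b\<^sub>0 b\<^sub>1 c\<^sub>0 =
          (\<lambda>c\<^sub>1. extension_value H (mat 1) (N 0 b\<^sub>0) (N 1 b\<^sub>1) (P 0 c\<^sub>0) (P 1 c\<^sub>1))" for b\<^sub>0 b\<^sub>1 c\<^sub>0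
        by (rule ext) (rule s_def)
      then show ?thesis by (simp only: extension_value_sum[symmetric] NP)
    qed
    also have "\<dots> = 1" by (simp add: extension_value_def tensor_mat_1 H(2))
    finally show ?thesis .
  qed
  moreover have "expectation \<rho> (M x a) (N y b) (P z c) =
      (\<Sum>(f, g, h)\<in>?\<Lambda>. w (f, g, h) * of_bool (f x = a \<and> g y = b \<and> h z = c))"
    if x: "x < mA" "a < rA x" and y: "y < 2" "b < rB y" and z: "z < 2" "c < rC z" for x y z a b c
  proof -
    \<comment> \<open>Writing \<open>g y\<close> and \<open>h z\<close> through the values at 0 and
      1 brings the summand into the shape required by \<open>sum_\<Lambda>\<close>.\<close>
    have "(\<Sum>(f, g, h)\<in>?\<Lambda>. w (f, g, h) * of_bool (f x = a \<and> g y = b \<and> h z = c)) =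
        (\<Sum>(f, g, h)\<in>?\<Lambda>. W f (g 0) (g 1) (h 0) (h 1) * of_bool (f x = a) *
          of_bool ((if y = 0 then g 0 else g 1) = b \<and> (if z = 0 then h 0 else h 1) = c))"
      using y z by (intro sum.cong) (auto simp: w_def less_2_cases_iff)
    also have "\<dots> = (\<Sum>b\<^sub>0<rB 0. \<Sum>b\<^sub>1<rB 1. \<Sum>c\<^sub>0<rC 0. \<Sum>c\<^sub>1<rC 1. q x a b\<^sub>0 b\<^sub>1 c\<^sub>0 c\<^sub>1 *
        of_bool ((if y = 0 then b\<^sub>0 else b\<^sub>1) = b \<and> (if z = 0 then c\<^sub>0 else c\<^sub>1) = c))"
      by (subst sum_\<Lambda>[where \<phi> = "\<lambda>f b\<^sub>0 b\<^sub>1 c\<^sub>0 c\<^sub>1. W f b\<^sub>0 b\<^sub>1 c\<^sub>0 c\<^sub>1 * of_bool (f x = a) *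
          of_bool ((if y = 0 then b\<^sub>0 else b\<^sub>1) = b \<and> (if z = 0 then c\<^sub>0 else c\<^sub>1) = c)"],
          intro sum.cong refl) (simp add: W_marginal x flip: sum_distrib_right)
    also have "\<dots> = (\<Sum>b\<^sub>0<rB 0. \<Sum>b\<^sub>1<rB 1. if (if y = 0 then b\<^sub>0 else b\<^sub>1) = b then
        \<Sum>c\<^sub>0<rC 0. \<Sum>c\<^sub>1<rC 1. if (if z = 0 then c\<^sub>0 else c\<^sub>1) = c
          then q x a b\<^sub>0 b\<^sub>1 c\<^sub>0 c\<^sub>1 else 0 else 0)"
    proof -
      have "(\<Sum>u<m. \<Sum>v<n. \<phi> u v * of_bool (R \<and> S u v))
          = (if R then \<Sum>u<m. \<Sum>v<n. if S u v then \<phi> u v else 0 else 0)"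
        for m n :: nat and \<phi> :: "nat \<Rightarrow> nat \<Rightarrow> real" and R S
        by (cases R) (auto intro!: sum.cong simp del: sum_mult_of_bool_eq)
      then show ?thesis by (intro sum.cong refl)
    qed
    also have "\<dots> = extension_value H (M x a) (N y b) (mat 1) (P z c) (mat 1)"
    proof -
      \<comment> \<open>For \<open>y = 1\<close> the outcome was read off from B', and the exchange
        symmetry carries it over to B; likewise for \<open>z = 1\<close> and C'.\<close>
      have BB: "extension_value H X (mat 1) Y Z Z' = extension_value H X Y (mat 1) Z Z'" for X Y Z Z'
        using H(3) by (rule extension_value_swap_BB')
      have CC: "extension_value H X Y Y' (mat 1) Z = extension_value H X Y Y' Z (mat 1)" for X Y Y' Z
        using H(4) by (rule extension_value_swap_CC')
      have q_eq: "q x a b\<^sub>0 b\<^sub>1 c\<^sub>0 =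
          (\<lambda>c\<^sub>1. extension_value H (M x a) (N 0 b\<^sub>0) (N 1 b\<^sub>1) (P 0 c\<^sub>0) (P 1 c\<^sub>1))" for b\<^sub>0 b\<^sub>1 c\<^sub>0
        by (rule ext) (rule q_def)
      have "y = 0 \<or> y = 1" "z = 0 \<or> z = 1" using y z by auto
      then show ?thesis
        unfolding sum_pair_delta[where r = rC, OF z] sum_pair_delta[where r = rB, OF y]
        by (elim disjE; simp only: q_eq refl if_True if_False one_neq_zero
            extension_value_sum[symmetric] NP BB CC)
    qed
    also have "\<dots> = expectation \<rho> (M x a) (N y b) (P z c)"
      unfolding extension_value_marginal H(5) ..
    finally show ?thesis by simp
  qed
  ultimately show "admits_lhv_model mA rA 2 rB 2 rC
      (\<lambda>a b c x y z. expectation \<rho> (M x a) (N y b) (P z c))"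
    unfolding admits_lhv_model_def Let_def by blast
qed

section \<open>Separability\<close>

lemma trace_scaleR: "trace (r *\<^sub>R M) = r *\<^sub>R trace M"
  by (simp add: trace_def scaleR_sum_right)

lemma trace_sum: "trace (\<Sum>k\<in>I. M k) = (\<Sum>k\<in>I. trace (M k))"
  unfolding trace_def by (simp, rule sum.swap)

lemma trace_tensor: "trace (tensor M N) = trace M * trace N"
  by (simp add: trace_def tensor_def sum_UNIV_prod sum_product)

lemma tensor_scaleR: "tensor (r *\<^sub>R M) (s *\<^sub>R N) = (r * s) *\<^sub>R tensor M N"
  by (simp add: vec_eq_iff tensor_def)

lemma trace_ketbra: "trace (ketbra v) = of_real (\<Sum>i\<in>UNIV. (cmod (v $ i))\<^sup>2)"
  by (simp add: trace_def ketbra_def complex_norm_square flip: of_real_power)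

text \<open>Separates the squared norm of a vector from a normalised state, so that product
  decompositions may be given with unnormalised vectors.\<close>

lemma ketbra_eq_scaleR_density:
  fixes v :: "complex ^ 'n::finite"
  obtains t \<alpha> where "0 \<le> t" "density_operator \<alpha>" "ketbra v = t *\<^sub>R \<alpha>"
proof (cases "v = 0")
  case True
  \<comment> \<open>For \<open>v = 0\<close> the weight is zero and any state will do; a basis
    projector serves as one.\<close>
  have "trace (ketbra (axis i 1 :: complex ^ 'n)) = 1" for i
  proof -
    have "(cmod (axis i 1 $ k))\<^sup>2 = (if k = i then 1 else 0)" for k :: 'n by (simp add: axis_def)
    then show ?thesis by (simp add: trace_ketbra)
  qed
  then have "density_operator (ketbra (axis undefined 1 :: complex ^ 'n))"
    by (simp add: density_operator_def positive_semidefinite_ketbra)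
  moreover have "ketbra v = 0 *\<^sub>R ketbra (axis undefined 1)"
    using True by (simp add: vec_eq_iff ketbra_def)
  ultimately show thesis by (rule that[OF order_refl])
next
  case False
  define t where "t = (\<Sum>i\<in>UNIV. (cmod (v $ i))\<^sup>2)"
  have "t \<noteq> 0" using False by (simp add: t_def sum_nonneg_eq_0_iff vec_eq_iff)
  moreover have t: "0 \<le> t" by (simp add: t_def sum_nonneg)
  moreover from calculation have "trace ((1 / t) *\<^sub>R ketbra v) = 1"
    unfolding trace_scaleR trace_ketbra t_def[symmetric] by (simp add: scaleR_conv_of_real)
  ultimately have "density_operator ((1 / t) *\<^sub>R ketbra v)"
    by (simp add: density_operator_def positive_semidefinite_scaleR positive_semidefinite_ketbra)
  then show thesis using \<open>t \<noteq> 0\<close> by (intro that[OF t]) auto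
qed

text \<open>Normalising the rank-one factors moves their squared norms into the weights. Product
  states have trace one, so the trace of \<sigma> is the sum of the new weights.\<close>

lemma separable_sum_ketbra:
  fixes a :: "'k \<Rightarrow> complex ^ 'a::finite" and b :: "'k \<Rightarrow> complex ^ 'b::finite"
  assumes "finite I" and "\<And>k. k \<in> I \<Longrightarrow> 0 \<le> w k"
    and \<sigma>: "\<sigma> = (\<Sum>k\<in>I. w k *\<^sub>R tensor (ketbra (a k)) (ketbra (b k)))" and "trace \<sigma> = 1"
  shows "separable \<sigma>"
proof -
  have "\<exists>t \<alpha>. 0 \<le> t \<and> density_operator \<alpha> \<and> ketbra v = t *\<^sub>R \<alpha>" for v :: "complex ^ 'n::finite"
    by (metis ketbra_eq_scaleR_density)
  then obtain s t \<alpha> \<beta> where \<alpha>: "\<And>v. 0 \<le> s v" "\<And>v. density_operator (\<alpha> v)"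
      "\<And>v :: complex ^ 'a. ketbra v = s v *\<^sub>R \<alpha> v"
    and \<beta>: "\<And>v. 0 \<le> t v" "\<And>v. density_operator (\<beta> v)"
      "\<And>v :: complex ^ 'b. ketbra v = t v *\<^sub>R \<beta> v"
    by metis
  obtain h where h: "bij_betw h {..<card I} I"
    using ex_bij_betw_nat_finite[OF assms(1)] by (auto simp: atLeast0LessThan)
  define p where "p k = w k * (s (a k) * t (b k))" for k
  have \<sigma>': "\<sigma> = (\<Sum>k\<in>I. p k *\<^sub>R tensor (\<alpha> (a k)) (\<beta> (b k)))"
    unfolding \<sigma> \<alpha>(3) \<beta>(3) tensor_scaleR by (simp add: p_def)
  have "trace (tensor (\<alpha> (a k)) (\<beta> (b k))) = 1" for k
    using \<alpha>(2) \<beta>(2) by (simp add: trace_tensor density_operator_def)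
  then have "trace \<sigma> = of_real (\<Sum>k\<in>I. p k)"
    by (simp only: \<sigma>' trace_sum trace_scaleR) (simp add: scaleR_conv_of_real)
  then have p: "(\<Sum>k\<in>I. p k) = 1" using assms(4) by (metis of_real_eq_1_iff)
  have "\<forall>k<card I. 0 \<le> p (h k) \<and> density_operator (\<alpha> (a (h k))) \<and> density_operator (\<beta> (b (h k)))"
    using \<alpha> \<beta> assms(2) bij_betwE[OF h] by (auto simp: p_def)
  moreover have "(\<Sum>k<card I. p (h k)) = 1"
    using p sum.reindex_bij_betw[OF h, of p] by simp
  moreover have "\<sigma> = (\<Sum>k<card I. p (h k) *\<^sub>R tensor (\<alpha> (a (h k))) (\<beta> (b (h k))))"
    unfolding \<sigma>'
    by (rule sum.reindex_bij_betw[OF h, of "\<lambda>k. p k *\<^sub>R tensor (\<alpha> (a k)) (\<beta> (b k))", symmetric])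
  ultimately show ?thesis unfolding separable_def by (intro exI conjI)
qed

text \<open>The form in which explicit decompositions are supplied below; the positions in the list
  serve as index set.\<close>

lemma separable_sum_list_ketbra:
  assumes "\<And>w a b. (w, a, b) \<in> set L \<Longrightarrow> 0 \<le> w"
    and "\<sigma> = (\<Sum>(w, a, b)\<leftarrow>L. w *\<^sub>R tensor (ketbra a) (ketbra b))" and "trace \<sigma> = 1"
  shows "separable \<sigma>"
proof (rule separable_sum_ketbra[where I = "{..<length L}" and w = "\<lambda>k. fst (L ! k)"
      and a = "\<lambda>k. fst (snd (L ! k))" and b = "\<lambda>k. snd (snd (L ! k))"])
  show "0 \<le> fst (L ! k)" if "k \<in> {..<length L}" for k
    using that assms(1)[of "fst (L ! k)" "fst (snd (L ! k))" "snd (snd (L ! k))"] by simp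
  show "\<sigma> = (\<Sum>k<length L. fst (L ! k) *\<^sub>R tensor (ketbra (fst (snd (L ! k)))) (ketbra (snd (snd (L ! k)))))"
    unfolding assms(2) by (simp add: sum_list_sum_nth atLeast0LessThan split_def)
qed (use assms(3) in simp_all)

section \<open>States with a classical party\<close>

text \<open>
  Party \<open>B\<close> holds the classical label \<open>\<beta>\<close> of a pure state \<open>v \<beta>\<close> on \<open>A, C, C'\<close>, up to
  normalisation; the label can be copied freely to \<open>B'\<close>.
\<close>

definition cq_extension ::
  "('b \<Rightarrow> complex ^ ('a \<times> 'c \<times> 'c)) \<Rightarrow> ('a::finite \<times> 'b::finite \<times> 'b \<times> 'c::finite \<times> 'c) operator"
  where "cq_extension v = (\<Sum>\<beta>\<in>UNIV. ketbra
    (\<chi> i. case i of (a, b, b', c, c') \<Rightarrow> if b = \<beta> \<and> b' = \<beta> then v \<beta> $ (a, c, c') else 0))"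

text \<open>The sum over \<open>c'\<close> runs over the basis states of the traced-out C'. Writing
  the partial trace of \<open>cq_extension\<close> as a sum of rank-one terms makes its positivity
  immediate.\<close>

definition cq_state ::
  "('b \<Rightarrow> complex ^ ('a \<times> 'c \<times> 'c)) \<Rightarrow> ('a::finite \<times> 'b::finite \<times> 'c::finite) operator"
  where "cq_state v = (\<Sum>\<beta>\<in>UNIV. \<Sum>c'\<in>UNIV. ketbra
    (\<chi> i. case i of (a, b, c) \<Rightarrow> if b = \<beta> then v \<beta> $ (a, c, c') else 0))"

lemma cq_extension_component:
  "cq_extension v $ (a, b, b', c, c') $ (d, e, e', f, f') =
    (if b = b' \<and> e = e' \<and> b = e then v b $ (a, c, c') * cnj (v b $ (d, f, f')) else 0)"
proof -
  have "cq_extension v $ (a, b, b', c, c') $ (d, e, e', f, f') =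
      (\<Sum>\<beta>\<in>UNIV. if \<beta> = b then (if b = b' \<and> e = e' \<and> b = e
        then v b $ (a, c, c') * cnj (v b $ (d, f, f')) else 0) else 0)"
    unfolding cq_extension_def sum_component ketbra_def by (rule sum.cong) auto
  then show ?thesis by simp
qed

lemma cq_state_component:
  "cq_state v $ (a, b, c) $ (d, e, f) =
    (if b = e then \<Sum>c'\<in>UNIV. v b $ (a, c, c') * cnj (v b $ (d, f, c')) else 0)"
proof -
  have "cq_state v $ (a, b, c) $ (d, e, f) =
      (\<Sum>\<beta>\<in>UNIV. if \<beta> = b then (if b = e
        then \<Sum>c'\<in>UNIV. v b $ (a, c, c') * cnj (v b $ (d, f, c')) else 0) else 0)"
    unfolding cq_state_def sum_component ketbra_def by (rule sum.cong) auto
  then show ?thesis by simp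
qed

lemma trace_cq_state:
  "trace (cq_state v) = (\<Sum>\<beta>\<in>UNIV. \<Sum>a\<in>UNIV. \<Sum>c\<in>UNIV. \<Sum>c'\<in>UNIV. v \<beta> $ (a, c, c') * cnj (v \<beta> $ (a, c, c')))"
  unfolding trace_def sum_UNIV_prod cq_state_component by simp (rule sum.swap)

lemma trace_cq_extension: "trace (cq_extension v) = trace (cq_state v)"
proof -
  have "trace (cq_extension v) = (\<Sum>a\<in>UNIV. \<Sum>b\<in>UNIV. \<Sum>b'\<in>UNIV. if b = b' then
      \<Sum>c\<in>UNIV. \<Sum>c'\<in>UNIV. v b $ (a, c, c') * cnj (v b $ (a, c, c')) else 0)"
    unfolding trace_def sum_UNIV_prod cq_extension_component by (intro sum.cong refl) auto
  also have "\<dots> = (\<Sum>a\<in>UNIV. \<Sum>b\<in>UNIV. \<Sum>c\<in>UNIV. \<Sum>c'\<in>UNIV. v b $ (a, c, c') * cnj (v b $ (a, c, c')))"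
    by simp
  also have "\<dots> = trace (cq_state v)" unfolding trace_cq_state by (rule sum.swap)
  finally show ?thesis .
qed

lemma density_operator_cq_state:
  assumes "0 \<le> r" and "trace (r *\<^sub>R cq_state v) = 1"
  shows "density_operator (r *\<^sub>R cq_state v)"
  using assms unfolding density_operator_def cq_state_def
  by (simp add: positive_semidefinite_scaleR positive_semidefinite_sum positive_semidefinite_ketbra)

text \<open>B and B' carry the same label, which gives their exchange symmetry; that of C and C' is
  the symmetry of the vectors. Tracing out B' discards only the copy of the label.\<close>

lemma symmetric_extension_cq_state:
  assumes "0 \<le> r" and "trace (r *\<^sub>R cq_state v) = 1"
    and sym: "\<And>\<beta> a c c'. v \<beta> $ (a, c, c') = v \<beta> $ (a, c', c)"
  shows "symmetric_extension (r *\<^sub>R cq_extension v) (r *\<^sub>R cq_state v)"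
  unfolding symmetric_extension_def
proof (intro conjI)
  have "positive_semidefinite (cq_extension v)"
    unfolding cq_extension_def by (simp add: positive_semidefinite_sum positive_semidefinite_ketbra)
  then show "density_operator (r *\<^sub>R cq_extension v)"
    using assms(1,2) by (simp add: density_operator_def positive_semidefinite_scaleR trace_scaleR
        trace_cq_extension)
  show "swap_BB' (r *\<^sub>R cq_extension v) = r *\<^sub>R cq_extension v"
    by (auto simp: vec_eq_iff swap_BB'_def cq_extension_component)
  show "swap_CC' (r *\<^sub>R cq_extension v) = r *\<^sub>R cq_extension v"
    using sym by (auto simp: vec_eq_iff swap_CC'_def cq_extension_component)
  have "(\<Sum>b'\<in>UNIV. \<Sum>c'\<in>UNIV. cq_extension v $ (a, b, b', c, c') $ (d, e, b', f, c'))
      = cq_state v $ (a, b, c) $ (d, e, f)" for a b c d e f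
  proof -
    have "(\<Sum>b'\<in>UNIV. \<Sum>c'\<in>UNIV. cq_extension v $ (a, b, b', c, c') $ (d, e, b', f, c'))
        = (\<Sum>b'\<in>UNIV. if b' = b then cq_state v $ (a, b, c) $ (d, e, f) else 0)"
      unfolding cq_extension_component cq_state_component by (rule sum.cong) auto
    then show ?thesis by simp
  qed
  then show "trace_B'C' (r *\<^sub>R cq_extension v) = r *\<^sub>R cq_state v"
    by (simp add: vec_eq_iff trace_B'C'_def flip: scaleR_sum_right)
qed

section \<open>Marginals containing the classical party\<close>

lemma trace_reduced_AB: "trace (reduced_AB \<rho>) = trace \<rho>"
  by (simp add: trace_def reduced_AB_def sum_UNIV_prod)

lemma trace_reduced_AC: "trace (reduced_AC \<rho>) = trace \<rho>"
  by (simp add: trace_def reduced_AC_def sum_UNIV_prod) (intro sum.cong refl sum.swap)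

lemma trace_reduced_BC: "trace (reduced_BC \<rho>) = trace \<rho>"
  by (simp add: trace_def reduced_BC_def sum_UNIV_prod) (rule sum_swap_3)

text \<open>Each product term pairs the label state \<beta> of B with the vector left on A once C
  and C' are projected onto basis states.\<close>

lemma separable_reduced_AB_cq_state:
  assumes "0 \<le> r" and "trace (r *\<^sub>R cq_state v) = 1"
  shows "separable (reduced_AB (r *\<^sub>R cq_state v))"
proof (rule separable_sum_ketbra[where I = UNIV and w = "\<lambda>_. r"
      and a = "\<lambda>(\<beta>, c, c'). \<chi> a. v \<beta> $ (a, c, c')" and b = "\<lambda>(\<beta>, c, c'). axis \<beta> 1"])
  have "reduced_AB (r *\<^sub>R cq_state v) $ (a, b) $ (d, e) =
      (\<Sum>(\<beta>, c, c')\<in>UNIV. r *\<^sub>R tensor (ketbra (\<chi> a. v \<beta> $ (a, c, c'))) (ketbra (axis \<beta> 1))) $ (a, b) $ (d, e)"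
    for a b d e
  proof -
    have "(\<Sum>(\<beta>, c, c')\<in>UNIV. r *\<^sub>R tensor (ketbra (\<chi> a. v \<beta> $ (a, c, c'))) (ketbra (axis \<beta> 1))) $ (a, b) $ (d, e)
      = (\<Sum>\<beta>\<in>UNIV. if \<beta> = b then (if b = e
          then \<Sum>c\<in>UNIV. \<Sum>c'\<in>UNIV. r *\<^sub>R (v b $ (a, c, c') * cnj (v b $ (d, c, c'))) else 0) else 0)"
      unfolding sum_component sum_UNIV_prod
      by (rule sum.cong) (auto simp: tensor_def ketbra_def axis_def)
    then show ?thesis
      by (simp add: reduced_AB_def cq_state_component scaleR_sum_right)
  qed
  then show "reduced_AB (r *\<^sub>R cq_state v) =
      (\<Sum>k\<in>UNIV. r *\<^sub>R tensor (ketbra (case k of (\<beta>, c, c') \<Rightarrow> \<chi> a. v \<beta> $ (a, c, c')))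
        (ketbra (case k of (\<beta>, c, c') \<Rightarrow> axis \<beta> 1)))"
    by (simp add: vec_eq_iff split_def)
qed (use assms in \<open>simp_all add: trace_reduced_AB\<close>)

text \<open>As for A and B, with A and C' projected onto basis states.\<close>

lemma separable_reduced_BC_cq_state:
  assumes "0 \<le> r" and "trace (r *\<^sub>R cq_state v) = 1"
  shows "separable (reduced_BC (r *\<^sub>R cq_state v))"
proof (rule separable_sum_ketbra[where I = UNIV and w = "\<lambda>_. r"
      and a = "\<lambda>(\<beta>, a, c'). axis \<beta> 1" and b = "\<lambda>(\<beta>, a, c'). \<chi> c. v \<beta> $ (a, c, c')"])
  have "reduced_BC (r *\<^sub>R cq_state v) $ (b, c) $ (e, f) =
      (\<Sum>(\<beta>, a, c')\<in>UNIV. r *\<^sub>R tensor (ketbra (axis \<beta> 1)) (ketbra (\<chi> c. v \<beta> $ (a, c, c')))) $ (b, c) $ (e, f)"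
    for b c e f
  proof -
    have "(\<Sum>(\<beta>, a, c')\<in>UNIV. r *\<^sub>R tensor (ketbra (axis \<beta> 1)) (ketbra (\<chi> c. v \<beta> $ (a, c, c')))) $ (b, c) $ (e, f)
      = (\<Sum>\<beta>\<in>UNIV. if \<beta> = b then (if b = e
          then \<Sum>a\<in>UNIV. \<Sum>c'\<in>UNIV. r *\<^sub>R (v b $ (a, c, c') * cnj (v b $ (a, f, c'))) else 0) else 0)"
      unfolding sum_component sum_UNIV_prod
      by (rule sum.cong) (auto simp: tensor_def ketbra_def axis_def)
    then show ?thesis
      by (simp add: reduced_BC_def cq_state_component scaleR_sum_right)
  qed
  then show "reduced_BC (r *\<^sub>R cq_state v) =
      (\<Sum>k\<in>UNIV. r *\<^sub>R tensor (ketbra (case k of (\<beta>, a, c') \<Rightarrow> axis \<beta> 1))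
        (ketbra (case k of (\<beta>, a, c') \<Rightarrow> \<chi> c. v \<beta> $ (a, c, c'))))"
    by (simp add: vec_eq_iff split_def)
qed (use assms in \<open>simp_all add: trace_reduced_BC\<close>)

text \<open>Applying an involution twice to an eigenvector shows that its eigenvalue squares to
  one.\<close>

lemma dichotomic_observableI:
  assumes "hermitian M" and "M ** M = mat 1"
  shows "dichotomic_observable M"
  unfolding dichotomic_observable_def
proof (intro conjI allI impI, fact, elim conjE)
  fix \<mu> v assume "v \<noteq> 0" and v: "M *v v = \<mu> *s v"
  have "v = (M ** M) *v v" by (simp add: assms(2))
  also have "\<dots> = \<mu> *s (\<mu> *s v)"
    unfolding matrix_vector_mul_assoc[symmetric] v
    by (simp add: v vector_scalar_commute)
  finally have "v = (\<mu> * \<mu>) *s v" by simp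
  moreover obtain i where "v $ i \<noteq> 0" using \<open>v \<noteq> 0\<close> by (auto simp: vec_eq_iff)
  ultimately have "\<mu> * \<mu> = 1" by (metis mult_cancel_right1 vector_smult_component)
  then show "\<mu> \<in> {-1, 1}" by (simp add: square_eq_1_iff disj_commute)
qed

section \<open>The violating states\<close>

text \<open>
  The triple \<open>(p, q, s)\<close> stands for the real symmetric matrix with rows \<open>(p, q)\<close> and \<open>(q, s)\<close>.
\<close>

definition real_sym_mat :: "real \<times> real \<times> real \<Rightarrow> qubit operator" where
  "real_sym_mat = (\<lambda>(p, q, s). \<chi> i j. of_real (if i = j then if i = 1 then p else s else q))"

text \<open>
  The basis elements of the symmetric subspace of \<open>C, C'\<close> are \<open>|00>\<close>, \<open>|01> + |10>\<close> and \<open>|11>\<close>; the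
  two triples are the coefficients for the two basis states of \<open>A\<close>.
\<close>

definition sym_vec ::
  "(real \<times> real \<times> real) \<times> (real \<times> real \<times> real) \<Rightarrow> complex ^ (qubit \<times> qubit \<times> qubit)" where
  "sym_vec = (\<lambda>((x\<^sub>0, x\<^sub>1, x\<^sub>2), (y\<^sub>0, y\<^sub>1, y\<^sub>2)). \<chi> i. case i of (a, c, c') \<Rightarrow> of_real
     (if a = 1 then if c \<noteq> c' then x\<^sub>1 else if c = 1 then x\<^sub>0 else x\<^sub>2
      else if c \<noteq> c' then y\<^sub>1 else if c = 1 then y\<^sub>0 else y\<^sub>2))"

text \<open>Index \<open>1\<close> denotes the first basis state, as in \<open>real_sym_mat\<close>
  and \<open>sym_vec\<close>.\<close>

definition qubit_vec :: "complex \<Rightarrow> complex \<Rightarrow> complex ^ qubit" where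
  "qubit_vec z z' = (\<chi> i. if i = 1 then z else z')"

lemma sym_vec_swap: "sym_vec X $ (a, c, c') = sym_vec X $ (a, c', c)"
  by (simp add: sym_vec_def split_def)

lemma mat_1_eq: "mat 1 = real_sym_mat (1, 0, 1)"
  by (simp add: vec_eq_iff mat_def real_sym_mat_def)

text \<open>The square has off-diagonal entry \<open>q * (p + s)\<close>, which the third assumption
  makes zero. The case \<open>q = 0\<close> covers the constant observables.\<close>

lemma dichotomic_observable_real_sym_mat:
  assumes "p\<^sup>2 + q\<^sup>2 = 1" "s\<^sup>2 + q\<^sup>2 = 1" "q = 0 \<or> s = - p"
  shows "dichotomic_observable (real_sym_mat (p, q, s))"
proof (rule dichotomic_observableI)
  show "hermitian (real_sym_mat (p, q, s))"
    by (simp add: hermitian_def real_sym_mat_def)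
  have "p * p + q * q = 1" "s * s + q * q = 1" using assms(1,2) by (simp_all add: power2_eq_square)
  then have "real_sym_mat (p, q, s) ** real_sym_mat (p, q, s) = real_sym_mat (1, 0, 1)"
    using assms(3)
    by (auto simp: vec_eq_iff forall_2 matrix_matrix_mult_def sum_2 real_sym_mat_def algebra_simps
        simp flip: of_real_mult of_real_add)
  then show "real_sym_mat (p, q, s) ** real_sym_mat (p, q, s) = mat 1" by (simp add: mat_1_eq)
qed

text \<open>The matrix element of the real symmetric matrix \<open>(p, q, s)\<close> between two
  real vectors.\<close>

definition bilinear_term :: "real \<times> real \<times> real \<Rightarrow> real \<times> real \<Rightarrow> real \<times> real \<Rightarrow> real" where
  "bilinear_term = (\<lambda>(p, q, s) (u, u') (w, w'). p * u * w + q * (u * w' + u' * w) + s * u' * w')"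

text \<open>The expectation value in one branch \<open>v \<beta>\<close>, with \<open>C'\<close> traced out.\<close>

definition branch_value ::
  "(real \<times> real \<times> real) \<times> (real \<times> real \<times> real) \<Rightarrow> real \<times> real \<times> real \<Rightarrow> real \<times> real \<times> real \<Rightarrow> real" where
  "branch_value = (\<lambda>((x\<^sub>0, x\<^sub>1, x\<^sub>2), (y\<^sub>0, y\<^sub>1, y\<^sub>2)) (p, q, s) C.
     p * (bilinear_term C (x\<^sub>0, x\<^sub>1) (x\<^sub>0, x\<^sub>1) + bilinear_term C (x\<^sub>1, x\<^sub>2) (x\<^sub>1, x\<^sub>2))
     + 2 * q * (bilinear_term C (x\<^sub>0, x\<^sub>1) (y\<^sub>0, y\<^sub>1) + bilinear_term C (x\<^sub>1, x\<^sub>2) (y\<^sub>1, y\<^sub>2))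
     + s * (bilinear_term C (y\<^sub>0, y\<^sub>1) (y\<^sub>0, y\<^sub>1) + bilinear_term C (y\<^sub>1, y\<^sub>2) (y\<^sub>1, y\<^sub>2)))"

definition qubit_cq_state ::
  "real \<Rightarrow> (real \<times> real \<times> real) \<times> (real \<times> real \<times> real) \<Rightarrow> (real \<times> real \<times> real) \<times> (real \<times> real \<times> real) \<Rightarrow>
     (qubit \<times> qubit \<times> qubit) operator" where
  "qubit_cq_state r X Y = r *\<^sub>R cq_state (\<lambda>\<beta>. sym_vec (if \<beta> = 1 then X else Y))"

text \<open>A diagonal observable of B weights the two branches by its eigenvalues. Within a branch,
  fixing the index of C' leaves C with the vectors \<open>(x\<^sub>0, x\<^sub>1)\<close> and
  \<open>(x\<^sub>1, x\<^sub>2)\<close> for the first basis state of A, and similarly with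
  \<open>y\<close> for the second; hence the pairs in \<open>branch_value\<close>.\<close>

lemma expectation_qubit_cq_state:
  "expectation (qubit_cq_state r X Y) (real_sym_mat A) (real_sym_mat (b, 0, b')) (real_sym_mat C)
   = r * (b * branch_value X A C + b' * branch_value Y A C)"
proof -
  obtain x\<^sub>0 x\<^sub>1 x\<^sub>2 y\<^sub>0 y\<^sub>1 y\<^sub>2 z\<^sub>0 z\<^sub>1 z\<^sub>2 w\<^sub>0 w\<^sub>1 w\<^sub>2 p q s p' q' s' where
    [simp]: "X = ((x\<^sub>0, x\<^sub>1, x\<^sub>2), (y\<^sub>0, y\<^sub>1, y\<^sub>2))" "Y = ((z\<^sub>0, z\<^sub>1, z\<^sub>2), (w\<^sub>0, w\<^sub>1, w\<^sub>2))"
      "A = (p, q, s)" "C = (p', q', s')"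
    by (metis prod.exhaust)
  show ?thesis
    unfolding expectation_def trace_mult_eq sum_UNIV_prod sum_2
    by (simp add: qubit_cq_state_def cq_state_component tensor3_def tensor_def sum_2
        real_sym_mat_def sym_vec_def)
      (simp add: branch_value_def bilinear_term_def algebra_simps)
qed

text \<open>Reduces each inequality to a finite rational certificate: two branch vectors, a product
  decomposition of the AC marginal, and the observables. The lists hold the trivial observable at
  position 0, and \<open>bs\<close> holds only diagonals because B is measured in its label
  basis.\<close>

lemma bell_violation_with_symmetric_extension:
  fixes as cs :: "(real \<times> real \<times> real) list" and bs :: "(real \<times> real) list"
    and X Y :: "(real \<times> real \<times> real) \<times> (real \<times> real \<times> real)" and r :: real
  defines "\<rho> \<equiv> qubit_cq_state r X Y"
  assumes "0 \<le> r" and tr: "trace \<rho> = 1"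
    and L: "\<And>w u v. (w, u, v) \<in> set L \<Longrightarrow> 0 \<le> w"
      "reduced_AC \<rho> = (\<Sum>(w, u, v)\<leftarrow>L. w *\<^sub>R tensor (ketbra u) (ketbra v))"
    and 0: "as ! 0 = (1, 0, 1)" "bs ! 0 = (1, 1)" "cs ! 0 = (1, 0, 1)"
    and dichotomic: "\<forall>i\<in>{1,2,3}. dichotomic_observable (real_sym_mat (as ! i)) \<and>
      dichotomic_observable (real_sym_mat (fst (bs ! i), 0, snd (bs ! i))) \<and>
      dichotomic_observable (real_sym_mat (cs ! i))"
    and F: "F (\<lambda>i j k. r * (fst (bs ! j) * branch_value X (as ! i) (cs ! k) +
      snd (bs ! j) * branch_value Y (as ! i) (cs ! k))) < 0"
  shows "\<exists>\<rho> :: (qubit \<times> qubit \<times> qubit) operator.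
      density_operator \<rho> \<and>
      violates_bell_inequality F \<rho> \<and>
      separable (reduced_AB \<rho>) \<and> separable (reduced_AC \<rho>) \<and> separable (reduced_BC \<rho>) \<and>
      (\<exists>H. symmetric_extension H \<rho>) \<and>
      (\<forall>(mA::nat) (rA :: nat \<Rightarrow> nat) (rB :: nat \<Rightarrow> nat) (rC :: nat \<Rightarrow> nat).
         violates_no_bell_inequality mA rA 2 rB 2 rC \<rho>)"
proof (intro exI conjI allI)
  define v where "v = (\<lambda>\<beta>. sym_vec (if \<beta> = (1::qubit) then X else Y))"
  have \<rho>: "\<rho> = r *\<^sub>R cq_state v" by (simp add: \<rho>_def v_def qubit_cq_state_def)
  note tr' = tr[unfolded \<rho>]
  show "density_operator \<rho>"
    unfolding \<rho> using \<open>0 \<le> r\<close> tr' by (rule density_operator_cq_state)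
  show "separable (reduced_AB \<rho>)"
    unfolding \<rho> using \<open>0 \<le> r\<close> tr' by (rule separable_reduced_AB_cq_state)
  show "separable (reduced_BC \<rho>)"
    unfolding \<rho> using \<open>0 \<le> r\<close> tr' by (rule separable_reduced_BC_cq_state)
  have "trace (reduced_AC \<rho>) = 1" unfolding trace_reduced_AC by (rule tr)
  with L show "separable (reduced_AC \<rho>)" by (rule separable_sum_list_ketbra)
  show ext: "symmetric_extension (r *\<^sub>R cq_extension v) \<rho>"
    unfolding \<rho> using \<open>0 \<le> r\<close> tr'
    by (rule symmetric_extension_cq_state) (simp add: v_def sym_vec_swap)
  show "violates_no_bell_inequality mA rA 2 rB 2 rC \<rho>" for mA rA rB rC
    using ext by (rule symmetric_extension_imp_violates_no_bell_inequality)
  show "violates_bell_inequality F \<rho>"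
    unfolding violates_bell_inequality_def
  proof (intro exI conjI)
    show "F (\<lambda>i j k. expectation \<rho> (real_sym_mat (as ! i))
        (real_sym_mat (fst (bs ! j), 0, snd (bs ! j))) (real_sym_mat (cs ! k))) < 0"
      using F by (simp add: \<rho>_def expectation_qubit_cq_state)
  qed (use dichotomic in \<open>simp_all add: 0 mat_1_eq\<close>)
qed

section \<open>Explicit certificates for the three inequalities\<close>

lemma trace_state_F1: "trace (qubit_cq_state (1 / 69) ((1, 1, 5), (1, 2, 0)) ((1, 2, 4), (-1, -1, 2))) = 1"
  unfolding qubit_cq_state_def trace_scaleR trace_cq_state
  by (simp add: sum_2 sym_vec_def scaleR_conv_of_real)

text \<open>This marginal equals its own partial transpose, which is consistent with a decomposition
  into real product vectors.\<close>

lemma reduced_AC_state_F1: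
  "reduced_AC (qubit_cq_state (1 / 69) ((1, 1, 5), (1, 2, 0)) ((1, 2, 4), (-1, -1, 2))) =
     (\<Sum>(w, u, v)\<leftarrow>
     [(17 / 4140, qubit_vec 3 1, qubit_vec 1 3),
      (11 / 2760, qubit_vec 1 (-3), qubit_vec 1 0),
      (5 / 3312, qubit_vec 3 (-1), qubit_vec 1 3),
      (5 / 483, qubit_vec 2 1, qubit_vec 1 2),
      (1 / 7728, qubit_vec 1 (-3), qubit_vec 3 (-1)),
      (1 / 920, qubit_vec 1 (-3), qubit_vec 2 (-1)),
      (1 / 46, qubit_vec 1 (-1), qubit_vec 0 1),
      (2 / 345, qubit_vec 2 (-1), qubit_vec 0 1)].
      w *\<^sub>R tensor (ketbra u) (ketbra v))"
  by (simp add: vec_eq_iff forall_2 reduced_AC_def qubit_cq_state_def cq_state_component sum_2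
      sym_vec_def qubit_vec_def tensor_def ketbra_def complex_eq_iff)

text \<open>Here B's first two observables are minus and plus the identity, and the third reads the
  label. Pythagorean triples make the rational observables of A and C exact involutions.\<close>

lemma bell_value_F1:
  defines "as \<equiv> [(1, 0, 1), (-5 / 13, -12 / 13, 5 / 13), (1, 0, -1), (-3 / 5, 4 / 5, 3 / 5)]"
    and "bs \<equiv> [(1, 1), (-1, -1), (1, 1), (1, -1)]"
    and "cs \<equiv> [(1, 0, 1), (-3 / 5, 4 / 5, 3 / 5), (12 / 13, -5 / 13, -12 / 13), (-3 / 5, -4 / 5, 3 / 5)]"
    and "X \<equiv> ((1, 1, 5), (1, 2, 0))" and "Y \<equiv> ((1, 2, 4), (-1, -1, 2))"
  shows "bell_F1 (\<lambda>i j k. 1 / 69 * (fst (bs ! j) * branch_value X (as ! i) (cs ! k) +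
    snd (bs ! j) * branch_value Y (as ! i) (cs ! k))) < 0"
  \<comment> \<open>Evaluating the sums with \<open>sum.insert_if\<close> counts coinciding
    permutations only once.\<close>
  unfolding assms by (simp add: bell_F1_def sym_corr_def sum.insert_if branch_value_def bilinear_term_def)

lemma trace_state_F2: "trace (qubit_cq_state (1 / 338) ((3, 0, 0), (11, -5, 2)) ((-2, -1, 5), (3, 5, 8))) = 1"
  unfolding qubit_cq_state_def trace_scaleR trace_cq_state
  by (simp add: sum_2 sym_vec_def scaleR_conv_of_real)

text \<open>Partial transposition changes this marginal but fixes projectors onto real product
  vectors, so complex vectors are unavoidable. They occur in conjugate pairs of equal weight, which
  cancels the imaginary parts.\<close>

lemma reduced_AC_state_F2:
  "reduced_AC (qubit_cq_state (1 / 338) ((3, 0, 0), (11, -5, 2)) ((-2, -1, 5), (3, 5, 8))) =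
     (\<Sum>(w, u, v)\<leftarrow>
     [(12611 / 3617952, qubit_vec 0 1, qubit_vec 5 (-1)),
      (21 / 1205984, qubit_vec 0 1, qubit_vec 5 1),
      (479 / 301496, qubit_vec 1 (Complex 2 (-2)), qubit_vec 2 (Complex (-1) (-2))),
      (479 / 301496, qubit_vec 1 (Complex 2 2), qubit_vec 2 (Complex (-1) 2)),
      (18419 / 3617952, qubit_vec 1 (Complex 1 (-2)), qubit_vec 1 (Complex 0 (-1))),
      (18419 / 3617952, qubit_vec 1 (Complex 1 2), qubit_vec 1 (Complex 0 1)),
      (7183 / 602992, qubit_vec 0 1, qubit_vec 4 1),
      (1271 / 301496, qubit_vec 1 (Complex 2 2), qubit_vec 1 (Complex 0 1)),
      (1271 / 301496, qubit_vec 1 (Complex 2 (-2)), qubit_vec 1 (Complex 0 (-1))),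
      (13813 / 3617952, qubit_vec 1 (Complex 1 1), qubit_vec 1 (Complex 0 2)),
      (13813 / 3617952, qubit_vec 1 (Complex 1 (-1)), qubit_vec 1 (Complex 0 (-2))),
      (23 / 602992, qubit_vec 1 5, qubit_vec 4 (-1)),
      (1 / 69576, qubit_vec 3 5, qubit_vec 1 (-5)),
      (519 / 602992, qubit_vec 1 (Complex 1 1), qubit_vec 1 (Complex (-1) 2)),
      (519 / 602992, qubit_vec 1 (Complex 1 (-1)), qubit_vec 1 (Complex (-1) (-2)))].
      w *\<^sub>R tensor (ketbra u) (ketbra v))"
  by (simp add: vec_eq_iff forall_2 reduced_AC_def qubit_cq_state_def cq_state_component sum_2
      sym_vec_def qubit_vec_def tensor_def ketbra_def complex_eq_iff)

text \<open>B's first two observables read the label with opposite signs and the third is the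
  identity; the same choice serves for \<open>bell_F3\<close>.\<close>

lemma bell_value_F2:
  defines "as \<equiv> [(1, 0, 1), (7 / 25, -24 / 25, -7 / 25), (-24 / 25, 7 / 25, 24 / 25), (-3 / 5, -4 / 5, 3 / 5)]"
    and "bs \<equiv> [(1, 1), (1, -1), (-1, 1), (1, 1)]"
    and "cs \<equiv> [(1, 0, 1), (-8 / 17, 15 / 17, 8 / 17), (4 / 5, -3 / 5, -4 / 5), (3 / 5, 4 / 5, -3 / 5)]"
    and "X \<equiv> ((3, 0, 0), (11, -5, 2))" and "Y \<equiv> ((-2, -1, 5), (3, 5, 8))"
  shows "bell_F2 (\<lambda>i j k. 1 / 338 * (fst (bs ! j) * branch_value X (as ! i) (cs ! k) +
    snd (bs ! j) * branch_value Y (as ! i) (cs ! k))) < 0"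
  unfolding assms by (simp add: bell_F2_def sym_corr_def sum.insert_if branch_value_def bilinear_term_def)

lemma trace_state_F3: "trace (qubit_cq_state (1 / 476) ((-5, 7, -6), (-5, 4, -4)) ((3, 5, 10), (7, 4, -2))) = 1"
  unfolding qubit_cq_state_def trace_scaleR trace_cq_state
  by (simp add: sum_2 sym_vec_def scaleR_conv_of_real)

text \<open>Conjugate pairs occur for the same reason as in the decomposition for
  \<open>bell_F2\<close>.\<close>

lemma reduced_AC_state_F3:
  "reduced_AC (qubit_cq_state (1 / 476) ((-5, 7, -6), (-5, 4, -4)) ((3, 5, 10), (7, 4, -2))) =
     (\<Sum>(w, u, v)\<leftarrow>
     [(39 / 20944, qubit_vec 2 (Complex 2 (-1)), qubit_vec 2 (Complex 0 (-1))),
      (39 / 20944, qubit_vec 2 (Complex 2 1), qubit_vec 2 (Complex 0 1)),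
      (131 / 62832, qubit_vec 4 1, qubit_vec 0 1),
      (3 / 5236, qubit_vec 1 0, qubit_vec 1 5),
      (11 / 1428, qubit_vec 1 1, qubit_vec 3 (-1)),
      (9 / 2618, qubit_vec 2 (Complex 1 (-1)), qubit_vec 1 (Complex 0 (-2))),
      (9 / 2618, qubit_vec 2 (Complex 1 1), qubit_vec 1 (Complex 0 2)),
      (111 / 20944, qubit_vec 2 (Complex 1 (-1)), qubit_vec 1 (Complex 0 (-1))),
      (111 / 20944, qubit_vec 2 (Complex 1 1), qubit_vec 1 (Complex 0 1)),
      (1 / 20944, qubit_vec 4 5, qubit_vec 4 (-1)),
      (313 / 1496, qubit_vec 1 0, qubit_vec 0 1),
      (1 / 5236, qubit_vec 2 (Complex 0 (-1)), qubit_vec 1 (Complex 1 (-2))),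
      (1 / 5236, qubit_vec 2 (Complex 0 1), qubit_vec 1 (Complex 1 2)),
      (1 / 10472, qubit_vec 3 4, qubit_vec 4 (-1))].
      w *\<^sub>R tensor (ketbra u) (ketbra v))"
  by (simp add: vec_eq_iff forall_2 reduced_AC_def qubit_cq_state_def cq_state_component sum_2
      sym_vec_def qubit_vec_def tensor_def ketbra_def complex_eq_iff)

lemma bell_value_F3:
  defines "as \<equiv> [(1, 0, 1), (-1, 0, 1), (5 / 13, 12 / 13, -5 / 13), (3 / 5, -4 / 5, -3 / 5)]"
    and "bs \<equiv> [(1, 1), (1, -1), (-1, 1), (1, 1)]"
    and "cs \<equiv> [(1, 0, 1), (-3 / 5, 4 / 5, 3 / 5), (0, -1, 0), (12 / 13, 5 / 13, -12 / 13)]"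
    and "X \<equiv> ((-5, 7, -6), (-5, 4, -4))" and "Y \<equiv> ((3, 5, 10), (7, 4, -2))"
  shows "bell_F3 (\<lambda>i j k. 1 / 476 * (fst (bs ! j) * branch_value X (as ! i) (cs ! k) +
    snd (bs ! j) * branch_value Y (as ! i) (cs ! k))) < 0"
  unfolding assms by (simp add: bell_F3_def sym_corr_def sum.insert_if branch_value_def bilinear_term_def)

theorem mainTheorem2:
  shows "\<forall>F \<in> {bell_F1, bell_F2, bell_F3}.
    \<exists>\<rho> :: (qubit \<times> qubit \<times> qubit) operator.
      density_operator \<rho> \<and>
      violates_bell_inequality F \<rho> \<and>
      separable (reduced_AB \<rho>) \<and> separable (reduced_AC \<rho>) \<and> separable (reduced_BC \<rho>) \<and>
      (\<exists>H. symmetric_extension H \<rho>) \<and>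
      (\<forall>(mA::nat) (rA :: nat \<Rightarrow> nat) (rB :: nat \<Rightarrow> nat) (rC :: nat \<Rightarrow> nat).
         violates_no_bell_inequality mA rA 2 rB 2 rC \<rho>)"
    (is "\<forall>F\<in>_. ?P F")
proof
  note dichotomic = dichotomic_observable_real_sym_mat power2_eq_square
  fix F assume "F \<in> {bell_F1, bell_F2, bell_F3}"
  then consider "F = bell_F1" | "F = bell_F2" | "F = bell_F3" by blast
  then show "?P F"
  proof cases
    case 1
    show ?thesis unfolding 1
      \<comment> \<open>What remains is nonnegativity of \<open>r\<close> and of the weights, the
        trivial entries at position 0, and that the nine observables are dichotomic.\<close>
      by (rule bell_violation_with_symmetric_extension[where F = bell_F1, OF _
            trace_state_F1 _ reduced_AC_state_F1 _ _ _ _ bell_value_F1])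
        (auto simp: dichotomic)
  next
    case 2
    show ?thesis unfolding 2
      by (rule bell_violation_with_symmetric_extension[where F = bell_F2, OF _
            trace_state_F2 _ reduced_AC_state_F2 _ _ _ _ bell_value_F2])
        (auto simp: dichotomic)
  next
    case 3
    show ?thesis unfolding 3
      by (rule bell_violation_with_symmetric_extension[where F = bell_F3, OF _
            trace_state_F3 _ reduced_AC_state_F3 _ _ _ _ bell_value_F3])
        (auto simp: dichotomic)
  qed
qed

end
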